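(* Let $K$ be a field, let $G$ be a finite group with set of conjugacy classes $\mathcal{C}$, and let $\mathfrak{r}=\sum_{C\in\mathcal{C}}\mathfrak{r}_C C$ be a ramification data of $G$, with associated Hopf graph $\Gamma_{G,\mathfrak{r}}$. Then the following statements are equivalent: (1) $L_K(\Gamma_{G,\mathfrak{r}})$ has IBN; (2) $L_K(\Gamma_{G,\mathfrak{r}})$ has gr-IBN; (3) $\sum_{C\in\mathcal{C}}\mathfrak{r}_C|C|\leq 1$.
   Context: A ramification data of a group $G$ is a function $\mathfrak{r}:\mathcal{C}\to\mathbb{N}=\{0,1,2,\dots\}$ on the set $\mathcal{C}$ of conjugacy classes of $G$, written $\mathfrak{r}=\sum_{C\in\mathcal{C}}\mathfrak{r}_C C$ with $\mathfrak{r}_C=\mathfrak{r}(C)$. The Hopf graph $\Gamma_{G,\mathfrak{r}}$ is the directed graph with vertex set $G$ and with $\mathfrak{r}_C$ edges from $x$ to $xc$ for each $x\in G$, $C\in\mathcal{C}$ and $c\in C$. A directed graph $E=(E^0,E^1,s,r)$ consists of disjoint sets $E^0$ (vertices) and $E^1$ (edges) with maps $s,r:E^1\to E^0$ (source, range). A vertex $v$ is regular if $0<|s^{-1}(v)|<\infty$. The Leavitt path algebra $L_K(E)$ is the $K$-algebra generated by $E^0\cup E^1\cup\{e^*\mid e\in E^1\}$ subject to, for all $v,w\in E^0$ and $e,f\in E^1$: (1) $vw=\delta_{v,w}w$; (2) $s(e)e=e=er(e)$ and $r(e)e^*=e^*=e^*s(e)$; (3) $e^*f=\delta_{e,f}r(e)$;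 (4) $v=\sum_{e\in s^{-1}(v)}ee^*$ for every regular vertex $v$. It is $\mathbb{Z}$-graded with $\deg v=0$, $\deg e=1$, $\deg e^*=-1$. A ring $R$ has IBN (Invariant Basis Number) if for all positive integers $m,n$, $R^m\cong R^n$ as right $R$-modules implies $m=n$. For an abelian group $\Gamma$, a $\Gamma$-graded ring $R$ and $\delta\in\Gamma$, the shifted graded right module $R(\delta)$ has components $R(\delta)_\gamma=R_{\delta+\gamma}$; $\cong_{gr}$ denotes isomorphism of right modules preserving degrees. $R$ has gr-IBN (Graded Invariant Basis Number) if for all positive integers $m,n$ and all $\alpha_1,\dots,\alpha_m,\beta_1,\dots,\beta_n\in\Gamma$, $R(\alpha_1)\oplus\cdots\oplus R(\alpha_m)\cong_{gr}R(\beta_1)\oplus\cdots\oplus R(\beta_n)$ as graded right $R$-modules implies $m=n$. *)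

theory Defs
  imports "Graph_Theory.Digraph" "HOL-Algebra.Group_Action" "HOL-Algebra.QuotRing" "HOL-Algebra.Module"
begin

section \<open>Ramification data and Hopf graphs\<close>

definition conjugacy_classes :: "('g, 'm) monoid_scheme \<Rightarrow> 'g set set" where
  "conjugacy_classes G =
     orbits G (carrier G) (\<lambda>g. \<lambda>h \<in> carrier G. g \<otimes>\<^bsub>G\<^esub> h \<otimes>\<^bsub>G\<^esub> inv\<^bsub>G\<^esub> g)"

text \<open>A ramification data of \<open>G\<close> is a function \<open>r :: 'g set \<Rightarrow> nat\<close>, of which only the values on
  the conjugacy classes of \<open>G\<close> are used. The \<open>r C\<close> parallel edges from \<open>x\<close> to \<open>x c\<close>, for \<open>c \<in> C\<close>,
  are the tuples \<open>(x, C, c, i)\<close> with \<open>i < r C\<close>.\<close>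

definition hopf_graph ::
  "('g, 'm) monoid_scheme \<Rightarrow> ('g set \<Rightarrow> nat) \<Rightarrow> ('g, 'g \<times> 'g set \<times> 'g \<times> nat) pre_digraph" where
  "hopf_graph G r =
     \<lparr>verts = carrier G,
      arcs = {(x, C, c, i). x \<in> carrier G \<and> C \<in> conjugacy_classes G \<and> c \<in> C \<and> i < r C},
      tail = (\<lambda>(x, C, c, i). x),
      head = (\<lambda>(x, C, c, i). x \<otimes>\<^bsub>G\<^esub> c)\<rparr>"


section \<open>Free associative algebras\<close>

text \<open>The unital free algebra on \<open>X\<close>: finitely supported functions from words over \<open>X\<close> to \<open>K\<close>,
  with the convolution product. A word is the basis element \<open>free_word K w\<close>.\<close>

definition free_algebra :: "('k, 'm) ring_scheme \<Rightarrow> 'x set \<Rightarrow> ('k, 'x list \<Rightarrow> 'k) module" where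
  "free_algebra K X =
     \<lparr>carrier = {f. (\<forall>w. f w \<in> carrier K) \<and> finite {w. f w \<noteq> \<zero>\<^bsub>K\<^esub>} \<and>
                    (\<forall>w. f w \<noteq> \<zero>\<^bsub>K\<^esub> \<longrightarrow> w \<in> lists X)},
      mult = (\<lambda>f g w. \<Oplus>\<^bsub>K\<^esub>i\<in>{..length w}. f (take i w) \<otimes>\<^bsub>K\<^esub> g (drop i w)),
      one = (\<lambda>w. if w = [] then \<one>\<^bsub>K\<^esub> else \<zero>\<^bsub>K\<^esub>),
      zero = (\<lambda>w. \<zero>\<^bsub>K\<^esub>),
      add = (\<lambda>f g w. f w \<oplus>\<^bsub>K\<^esub> g w),
      smult = (\<lambda>k f w. k \<otimes>\<^bsub>K\<^esub> f w)\<rparr>"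

definition free_word :: "('k, 'm) ring_scheme \<Rightarrow> 'x list \<Rightarrow> 'x list \<Rightarrow> 'k" where
  "free_word K w = (\<lambda>u. if u = w then \<one>\<^bsub>K\<^esub> else \<zero>\<^bsub>K\<^esub>)"


section \<open>Leavitt path algebras\<close>

datatype ('v, 'e) lpa_gen = Vertex 'v | Edge 'e | Ghost 'e

definition lpa_gens :: "('v, 'e) pre_digraph \<Rightarrow> ('v, 'e) lpa_gen set" where
  "lpa_gens E = Vertex ` verts E \<union> Edge ` arcs E \<union> Ghost ` arcs E"

definition regular_vertices :: "('v, 'e) pre_digraph \<Rightarrow> 'v set" where
  "regular_vertices E = {v \<in> verts E. out_arcs E v \<noteq> {} \<and> finite (out_arcs E v)}"

abbreviation lpa_free ::
  "('k, 'm) ring_scheme \<Rightarrow> ('v, 'e) pre_digraph \<Rightarrow> ('k, ('v, 'e) lpa_gen list \<Rightarrow> 'k) module" where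
  "lpa_free K E \<equiv> free_algebra K (lpa_gens E)"

definition lpa_relations ::
  "('k, 'm) ring_scheme \<Rightarrow> ('v, 'e) pre_digraph \<Rightarrow> (('v, 'e) lpa_gen list \<Rightarrow> 'k) set" where
  "lpa_relations K E =
    (let F = lpa_free K E;
         vx = (\<lambda>v. free_word K [Vertex v]);
         ed = (\<lambda>e. free_word K [Edge e]);
         gh = (\<lambda>e. free_word K [Ghost e])
     in {vx v \<otimes>\<^bsub>F\<^esub> vx w \<ominus>\<^bsub>F\<^esub> (if v = w then vx w else \<zero>\<^bsub>F\<^esub>) | v w. v \<in> verts E \<and> w \<in> verts E}
      \<union> {vx (tail E e) \<otimes>\<^bsub>F\<^esub> ed e \<ominus>\<^bsub>F\<^esub> ed e | e. e \<in> arcs E}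
      \<union> {ed e \<otimes>\<^bsub>F\<^esub> vx (head E e) \<ominus>\<^bsub>F\<^esub> ed e | e. e \<in> arcs E}
      \<union> {vx (head E e) \<otimes>\<^bsub>F\<^esub> gh e \<ominus>\<^bsub>F\<^esub> gh e | e. e \<in> arcs E}
      \<union> {gh e \<otimes>\<^bsub>F\<^esub> vx (tail E e) \<ominus>\<^bsub>F\<^esub> gh e | e. e \<in> arcs E}
      \<union> {gh e \<otimes>\<^bsub>F\<^esub> ed f \<ominus>\<^bsub>F\<^esub> (if e = f then vx (head E e) else \<zero>\<^bsub>F\<^esub>) | e f. e \<in> arcs E \<and> f \<in> arcs E}
      \<union> {vx v \<ominus>\<^bsub>F\<^esub> (\<Oplus>\<^bsub>F\<^esub>e\<in>out_arcs E v. ed e \<otimes>\<^bsub>F\<^esub> gh e) | v. v \<in> regular_vertices E})"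

definition lpa_ideal ::
  "('k, 'm) ring_scheme \<Rightarrow> ('v, 'e) pre_digraph \<Rightarrow> (('v, 'e) lpa_gen list \<Rightarrow> 'k) set" where
  "lpa_ideal K E = Idl\<^bsub>lpa_free K E\<^esub> (lpa_relations K E)"

text \<open>The presentation of a Leavitt path algebra is one of a not necessarily unital algebra:
  \<open>L\<^sub>K(E) = F\<^sup>+/I\<close>, where \<open>F\<^sup>+\<close> is the span of the nonempty words in the free algebra \<open>F\<close> and \<open>I\<close> is
  the ideal generated by the relations. All relations lie in \<open>F\<^sup>+\<close>, and since \<open>F = K 1 + F\<^sup>+\<close>, the
  algebra ideal of \<open>F\<^sup>+\<close> and the ideal of \<open>F\<close> generated by them coincide.
  (The quotient \<open>F/I\<close> would be the unitization of \<open>L\<^sub>K(E)\<close>.)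
  If the vertex set is finite, the sum of all vertices is the identity of \<open>L\<^sub>K(E)\<close>;
  the field \<open>one\<close> is meaningless otherwise.\<close>

definition leavitt_path_algebra ::
  "('k, 'm) ring_scheme \<Rightarrow> ('v, 'e) pre_digraph \<Rightarrow> ('k, (('v, 'e) lpa_gen list \<Rightarrow> 'k) set) module" where
  "leavitt_path_algebra K E =
    (let F = lpa_free K E; I = lpa_ideal K E
     in \<lparr>carrier = {I +>\<^bsub>F\<^esub> a | a. a \<in> carrier F \<and> a [] = \<zero>\<^bsub>K\<^esub>},
         mult = rcoset_mult F I,
         one = I +>\<^bsub>F\<^esub> (\<Oplus>\<^bsub>F\<^esub>v\<in>verts E. free_word K [Vertex v]),
         zero = I,
         add = set_add F,
         smult = (\<lambda>k. rcoset_mult F I (I +>\<^bsub>F\<^esub> (k \<odot>\<^bsub>F\<^esub> \<one>\<^bsub>F\<^esub>)))\<rparr>)"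

primrec gen_degree :: "('v, 'e) lpa_gen \<Rightarrow> int" where
  "gen_degree (Vertex v) = 0"
| "gen_degree (Edge e) = 1"
| "gen_degree (Ghost e) = -1"

definition lpa_grading ::
  "('k, 'm) ring_scheme \<Rightarrow> ('v, 'e) pre_digraph \<Rightarrow> int \<Rightarrow> (('v, 'e) lpa_gen list \<Rightarrow> 'k) set set" where
  "lpa_grading K E n =
    (let F = lpa_free K E; I = lpa_ideal K E
     in {I +>\<^bsub>F\<^esub> a | a. a \<in> carrier F \<and>
           (\<forall>w. a w \<noteq> \<zero>\<^bsub>K\<^esub> \<longrightarrow> w \<noteq> [] \<and> sum_list (map gen_degree w) = n)})"


section \<open>Invariant basis number\<close>

text \<open>Right modules are stored in the record \<open>module\<close>, whose scalar comes first:
  \<open>a \<odot>\<^bsub>M\<^esub> x\<close> stands for \<open>x a\<close>. The ring multiplication of the record is not used.\<close>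

definition free_right_module :: "('a, 'm) ring_scheme \<Rightarrow> nat \<Rightarrow> ('a, nat \<Rightarrow> 'a) module" where
  "free_right_module R n =
     \<lparr>carrier = {..<n} \<rightarrow>\<^sub>E carrier R,
      mult = undefined,
      one = undefined,
      zero = (\<lambda>i\<in>{..<n}. \<zero>\<^bsub>R\<^esub>),
      add = (\<lambda>x y. \<lambda>i\<in>{..<n}. x i \<oplus>\<^bsub>R\<^esub> y i),
      smult = (\<lambda>a x. \<lambda>i\<in>{..<n}. x i \<otimes>\<^bsub>R\<^esub> a)\<rparr>"

definition right_module_iso ::
  "('a, 'm) ring_scheme \<Rightarrow> ('a, 'x) module \<Rightarrow> ('a, 'y) module \<Rightarrow> ('x \<Rightarrow> 'y) set" where
  "right_module_iso R M N =
     {h \<in> iso (add_monoid M) (add_monoid N).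
        \<forall>a\<in>carrier R. \<forall>x\<in>carrier M. h (a \<odot>\<^bsub>M\<^esub> x) = a \<odot>\<^bsub>N\<^esub> h x}"

definition IBN :: "('a, 'm) ring_scheme \<Rightarrow> bool" where
  "IBN R \<longleftrightarrow>
     (\<forall>m n. 0 < m \<longrightarrow> 0 < n \<longrightarrow>
        right_module_iso R (free_right_module R m) (free_right_module R n) \<noteq> {} \<longrightarrow> m = n)"

text \<open>A grading of a ring or module is given by its family of homogeneous components. Below, \<open>A\<close>
  is the grading of \<open>R\<close>, and \<open>direct_sum_grading\<close> is the grading of
  \<open>R(\<alpha> 0) \<oplus> \<dots> \<oplus> R(\<alpha> (n - 1))\<close>, whose underlying module is \<open>free_right_module R n\<close>.\<close>

definition shift_grading :: "('c::ab_group_add \<Rightarrow> 'a set) \<Rightarrow> 'c \<Rightarrow> 'c \<Rightarrow> 'a set" where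
  "shift_grading A \<delta> = (\<lambda>\<gamma>. A (\<delta> + \<gamma>))"

definition direct_sum_grading ::
  "('c::ab_group_add \<Rightarrow> 'a set) \<Rightarrow> nat \<Rightarrow> (nat \<Rightarrow> 'c) \<Rightarrow> 'c \<Rightarrow> (nat \<Rightarrow> 'a) set" where
  "direct_sum_grading A n \<alpha> \<gamma> = (\<Pi>\<^sub>E i\<in>{..<n}. shift_grading A (\<alpha> i) \<gamma>)"

definition gr_IBN :: "('a, 'm) ring_scheme \<Rightarrow> ('c::ab_group_add \<Rightarrow> 'a set) \<Rightarrow> bool" where
  "gr_IBN R A \<longleftrightarrow>
     (\<forall>m n (\<alpha> :: nat \<Rightarrow> 'c) (\<beta> :: nat \<Rightarrow> 'c). 0 < m \<longrightarrow> 0 < n \<longrightarrow>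
        (\<exists>h \<in> right_module_iso R (free_right_module R m) (free_right_module R n).
           \<forall>\<gamma>. h ` direct_sum_grading A m \<alpha> \<gamma> \<subseteq> direct_sum_grading A n \<beta> \<gamma>) \<longrightarrow> m = n)"

end

theory Submission
  imports Defs "HOL-Algebra.UnivPoly"
begin

text \<open>
  Let \<open>d\<close> be the sum of the numbers \<open>r C * card C\<close>. Every vertex of the Hopf graph emits exactly \<open>d\<close>
  edges, one for each label \<open>(C, c, i)\<close> with \<open>c \<in> C\<close> and \<open>i < r C\<close>; and since the edges with a fixed label
  realise the permutation \<open>x \<mapsto> x c\<close> of the group, every vertex also receives exactly one edge of
  each label. The three statements are shown to be equivalent in a cycle.

  Invariant basis number implies its graded form because a graded isomorphism is an isomorphism.

  If \<open>d \<ge> 2\<close>, let \<open>a_l\<close> be the sum of all edges with label \<open>l\<close> and \<open>b_l\<close> the sum of their ghosts. Then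
  \<open>b_l a_m = \<delta>_lm\<close> and \<open>\<Sum> a_l b_l = 1\<close> (\<open>not_gr_IBN_if_permutation_labelled\<close>). Such elements give an
  isomorphism from \<open>L\<close> to \<open>L^d\<close>, which is graded up to a shift by \<open>-1\<close> as the \<open>b_l\<close> have degree \<open>-1\<close>
  (\<open>Leavitt_relations_imp_not_gr_IBN\<close>). So graded invariant basis number fails.

  If \<open>d \<le> 1\<close>, the algebra has a unital representation by matrices over \<open>K\<close> indexed by the group, in which
  vertices, edges and ghosts are matrix units (\<open>IBN_if_out_degree_le_1\<close>). An isomorphism of free
  modules of ranks \<open>m\<close> and \<open>n\<close> amounts to a pair of mutually inverse matrices over the algebra. The
  representation turns them into mutually inverse block matrices over the field \<open>K\<close>, whence
  \<open>m = n\<close> (locale \<open>matrix_representation\<close>).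

  To define the representation on the algebra as presented, the free algebra is shown to be a ring
  whose evaluation at any family of matrices is multiplicative (\<open>eval_matrix_mult\<close>), and the
  quotient is shown to be a ring with the sum of the vertices as identity (\<open>lpa_ring\<close>).\<close>

section \<open>Finite sums and linear systems over a field\<close>

lemma (in abelian_monoid) finsum_Times:
  assumes "finite A" "finite B" "\<And>a b. a \<in> A \<Longrightarrow> b \<in> B \<Longrightarrow> f a b \<in> carrier G"
  shows "(\<Oplus>p\<in>A \<times> B. f (fst p) (snd p)) = (\<Oplus>a\<in>A. \<Oplus>b\<in>B. f a b)"
  using assms(1,3)
proof (induction A rule: finite_induct)
  case empty
  then show ?case by simp
next
  case (insert a A)
  have eq: "insert a A \<times> B = Pair a ` B \<union> A \<times> B" by auto
  have "(\<Oplus>p\<in>insert a A \<times> B. f (fst p) (snd p)) =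
      (\<Oplus>p\<in>Pair a ` B. f (fst p) (snd p)) \<oplus> (\<Oplus>p\<in>A \<times> B. f (fst p) (snd p))"
    unfolding eq using insert assms(2) by (intro finsum_Un_disjoint) auto
  also have "(\<Oplus>p\<in>Pair a ` B. f (fst p) (snd p)) = (\<Oplus>b\<in>B. f a b)"
    using insert.prems by (subst finsum_reindex) (auto simp: inj_on_def)
  finally show ?case
    using insert by (simp add: finsum_insert Pi_def)
qed

lemma (in abelian_monoid) finsum_swap:
  assumes "finite A" "finite B" "\<And>a b. a \<in> A \<Longrightarrow> b \<in> B \<Longrightarrow> f a b \<in> carrier G"
  shows "(\<Oplus>a\<in>A. \<Oplus>b\<in>B. f a b) = (\<Oplus>b\<in>B. \<Oplus>a\<in>A. f a b)"
  using assms(1,3)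
proof (induction A rule: finite_induct)
  case empty
  then show ?case by simp
next
  case (insert a A)
  have "(\<Oplus>x\<in>insert a A. \<Oplus>b\<in>B. f x b) = (\<Oplus>b\<in>B. f a b) \<oplus> (\<Oplus>b\<in>B. \<Oplus>x\<in>A. f x b)"
    using insert by (simp add: Pi_def)
  also have "\<dots> = (\<Oplus>b\<in>B. f a b \<oplus> (\<Oplus>x\<in>A. f x b))"
    using insert.prems by (intro finsum_addf[symmetric]) auto
  also have "\<dots> = (\<Oplus>b\<in>B. \<Oplus>x\<in>insert a A. f x b)"
    using insert by (intro finsum_cong') (auto simp: Pi_def)
  finally show ?case .
qed

lemma (in abelian_monoid) finsum_delta:
  assumes "finite A" "a \<in> A" "f a \<in> carrier G"
  shows "(\<Oplus>x\<in>A. if x = a then f x else \<zero>) = f a"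
proof -
  have "(\<Oplus>x\<in>A. if x = a then f x else \<zero>) = (\<Oplus>x\<in>A. if a = x then f a else \<zero>)"
    using assms by (intro finsum_cong') auto
  also have "\<dots> = f a"
    using finsum_singleton[OF assms(2,1), of "\<lambda>_. f a"] assms(3) by simp
  finally show ?thesis .
qed

text \<open>Gaussian elimination, by induction on the set \<open>Q\<close> of equations: a nonzero coefficient
  \<open>b q0 p0\<close> is used to solve the equation \<open>q0\<close> for the unknown \<open>p0\<close>, and the
  induction hypothesis applies to the remaining equations in the remaining unknowns.\<close>

lemma (in field) nontrivial_solution:
  assumes "finite Q" "finite P" "card Q < card P"
    and "\<And>q p. q \<in> Q \<Longrightarrow> p \<in> P \<Longrightarrow> b q p \<in> carrier R"
  shows "\<exists>x. (\<forall>p. x p \<in> carrier R) \<and> (\<exists>p\<in>P. x p \<noteq> \<zero>) \<and> (\<forall>q\<in>Q. (\<Oplus>p\<in>P. b q p \<otimes> x p) = \<zero>)"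
  using assms
proof (induction Q arbitrary: P b rule: finite_induct)
  case empty
  then have "P \<noteq> {}" by auto
  then show ?case by (intro exI[of _ "\<lambda>_. \<one>"]) auto
next
  case (insert q0 Q)
  note b = insert.prems(3)
  show ?case
  proof (cases "\<forall>p\<in>P. b q0 p = \<zero>")
    case True
    obtain x where x: "\<forall>p. x p \<in> carrier R" "\<exists>p\<in>P. x p \<noteq> \<zero>"
      "\<forall>q\<in>Q. (\<Oplus>p\<in>P. b q p \<otimes> x p) = \<zero>"
      using insert.IH[of P b] insert.prems insert.hyps by auto
    have "(\<Oplus>p\<in>P. b q0 p \<otimes> x p) = (\<Oplus>p\<in>P. \<zero>)"
      using x True by (intro finsum_cong') auto
    with x show ?thesis by (intro exI[of _ x]) simp
  next
    case False
    then obtain p0 where p0: "p0 \<in> P" "b q0 p0 \<noteq> \<zero>" by auto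
    define P' where "P' = P - {p0}"
    have fin: "finite P'" and P: "P = insert p0 P'" "p0 \<notin> P'"
      using p0 insert.prems by (auto simp: P'_def)
    define u where "u = inv (b q0 p0)"
    have u: "u \<in> carrier R" "b q0 p0 \<otimes> u = \<one>"
      using p0 b[of q0 p0] by (auto simp: u_def field_Units)
    \<comment> \<open>the equation \<open>q\<close> after the unknown \<open>p0\<close> has been eliminated from it by means of \<open>q0\<close>\<close>
    define b' where "b' q p = b q p \<ominus> b q p0 \<otimes> u \<otimes> b q0 p" for q p
    have card: "card Q < card P'" using insert.prems insert.hyps fin P by simp
    obtain x where x: "\<forall>p. x p \<in> carrier R" "\<exists>p\<in>P'. x p \<noteq> \<zero>"
      "\<forall>q\<in>Q. (\<Oplus>p\<in>P'. b' q p \<otimes> x p) = \<zero>"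
      using insert.IH[OF fin card, of b'] b u P unfolding b'_def by auto
    define s where "s q = (\<Oplus>p\<in>P'. b q p \<otimes> x p)" for q
    have s: "s q \<in> carrier R" if "q \<in> insert q0 Q" for q
      using x b[of q] that P unfolding s_def by (intro finsum_closed) auto
    \<comment> \<open>the value at \<open>p0\<close> that makes the equation \<open>q0\<close> hold\<close>
    define y where "y = x(p0 := \<ominus> (u \<otimes> s q0))"
    have y: "\<forall>p. y p \<in> carrier R" using x s u by (auto simp: y_def)
    have sum_y: "(\<Oplus>p\<in>P. b q p \<otimes> y p) = s q \<ominus> b q p0 \<otimes> u \<otimes> s q0" if q: "q \<in> insert q0 Q" for q
    proof -
      have "(\<Oplus>p\<in>P. b q p \<otimes> y p) = b q p0 \<otimes> y p0 \<oplus> (\<Oplus>p\<in>P'. b q p \<otimes> y p)"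
        unfolding P(1) using fin P y b[OF q] by (intro finsum_insert) auto
      also have "(\<Oplus>p\<in>P'. b q p \<otimes> y p) = s q"
        unfolding s_def using P x b[OF q] by (intro finsum_cong') (auto simp: y_def)
      also have "b q p0 \<otimes> y p0 \<oplus> s q = s q \<ominus> b q p0 \<otimes> u \<otimes> s q0"
        using s q u b[OF q p0(1)] by (simp add: y_def minus_eq r_minus m_assoc a_comm)
      finally show ?thesis .
    qed
    have "(\<Oplus>p\<in>P. b q p \<otimes> y p) = \<zero>" if q: "q \<in> insert q0 Q" for q
    proof (cases "q = q0")
      case True
      then show ?thesis
        using sum_y[OF q] s[OF q] u b[OF q p0(1)] by (simp add: a_minus_def r_neg)
    next
      case False
      with q have qQ: "q \<in> Q" by simp
      have "\<zero> = (\<Oplus>p\<in>P'. b q p \<otimes> x p \<oplus> (\<ominus> (b q p0 \<otimes> u)) \<otimes> (b q0 p \<otimes> x p))"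
      proof -
        have "b q p \<otimes> x p \<oplus> (\<ominus> (b q p0 \<otimes> u)) \<otimes> (b q0 p \<otimes> x p) = b' q p \<otimes> x p"
          if "p \<in> P'" for p
          using that P u b[OF q, of p] b[OF q, of p0] b[of q0 p] x(1) p0 unfolding b'_def
          by (simp add: minus_eq l_distr l_minus m_assoc)
        moreover have "b' q p \<otimes> x p \<in> carrier R" if "p \<in> P'" for p
          using that P u b[OF q, of p] b[OF q, of p0] b[of q0 p] x(1) p0 unfolding b'_def by simp
        ultimately have "(\<Oplus>p\<in>P'. b q p \<otimes> x p \<oplus> (\<ominus> (b q p0 \<otimes> u)) \<otimes> (b q0 p \<otimes> x p)) =
            (\<Oplus>p\<in>P'. b' q p \<otimes> x p)"
          by (intro finsum_cong') auto
        then show ?thesis using x(3) qQ by auto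
      qed
      also have "\<dots> = s q \<oplus> (\<Oplus>p\<in>P'. (\<ominus> (b q p0 \<otimes> u)) \<otimes> (b q0 p \<otimes> x p))"
        unfolding s_def using P u b[OF q] b[of q0] x(1) by (intro finsum_addf) auto
      also have "(\<Oplus>p\<in>P'. (\<ominus> (b q p0 \<otimes> u)) \<otimes> (b q0 p \<otimes> x p)) = (\<ominus> (b q p0 \<otimes> u)) \<otimes> s q0"
        unfolding s_def using fin P u b[OF q] b[of q0] x(1) by (subst finsum_rdistr) auto
      finally show ?thesis
        using sum_y[OF q] s[OF q] s[of q0] u b[OF q p0(1)] by (simp add: a_minus_def l_minus)
    qed
    moreover have "\<exists>p\<in>P. y p \<noteq> \<zero>" using x(2) P by (auto simp: y_def)
    ultimately show ?thesis using y by blast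
  qed
qed

text \<open>A matrix \<open>b\<close> with a left inverse has no kernel, so it cannot have more columns than rows.
  This is the invariant basis number of fields, for matrices indexed by arbitrary finite sets.\<close>

lemma (in field) left_invertible_matrix_card_le:
  assumes fin: "finite P" "finite Q"
    and a: "\<And>p q. p \<in> P \<Longrightarrow> q \<in> Q \<Longrightarrow> a p q \<in> carrier R"
    and b: "\<And>q p. q \<in> Q \<Longrightarrow> p \<in> P \<Longrightarrow> b q p \<in> carrier R"
    and ab: "\<And>p p'. p \<in> P \<Longrightarrow> p' \<in> P \<Longrightarrow>
      (\<Oplus>q\<in>Q. a p q \<otimes> b q p') = (if p = p' then \<one> else \<zero>)"
  shows "card P \<le> card Q"
proof (rule ccontr)
  assume "\<not> card P \<le> card Q"
  then have "\<exists>x. (\<forall>p. x p \<in> carrier R) \<and> (\<exists>p\<in>P. x p \<noteq> \<zero>) \<and>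
      (\<forall>q\<in>Q. (\<Oplus>p\<in>P. b q p \<otimes> x p) = \<zero>)"
    using fin b by (intro nontrivial_solution) auto
  then obtain x where x: "\<forall>p. x p \<in> carrier R" "\<exists>p\<in>P. x p \<noteq> \<zero>"
    "\<forall>q\<in>Q. (\<Oplus>p\<in>P. b q p \<otimes> x p) = \<zero>"
    by blast
  have "x p = \<zero>" if p: "p \<in> P" for p
  proof -
    have "x p = (\<Oplus>p'\<in>P. if p' = p then x p' else \<zero>)"
      using finsum_delta[of P p x] fin p x by simp
    also have "\<dots> = (\<Oplus>p'\<in>P. (\<Oplus>q\<in>Q. a p q \<otimes> b q p') \<otimes> x p')"
      using ab p x by (intro finsum_cong') auto
    also have "\<dots> = (\<Oplus>p'\<in>P. \<Oplus>q\<in>Q. a p q \<otimes> (b q p' \<otimes> x p'))"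
      using a b p x fin by (intro finsum_cong') (auto simp: finsum_ldistr m_assoc intro!: finsum_cong' finsum_closed)
    also have "\<dots> = (\<Oplus>q\<in>Q. \<Oplus>p'\<in>P. a p q \<otimes> (b q p' \<otimes> x p'))"
      using a b p x fin by (intro finsum_swap) auto
    also have "\<dots> = (\<Oplus>q\<in>Q. \<zero>)"
    proof (rule finsum_cong')
      fix q assume q: "q \<in> Q"
      have "(\<Oplus>p'\<in>P. a p q \<otimes> (b q p' \<otimes> x p')) = a p q \<otimes> (\<Oplus>p'\<in>P. b q p' \<otimes> x p')"
        using a b p x fin q by (subst finsum_rdistr) auto
      then show "(\<Oplus>p'\<in>P. a p q \<otimes> (b q p' \<otimes> x p')) = \<zero>"
        using a p q x by simp
    qed auto
    finally show ?thesis by simp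
  qed
  with x show False by blast
qed

section \<open>Rings with a matrix representation have invariant basis number\<close>

definition unit_vec :: "('a, 'm) ring_scheme \<Rightarrow> nat \<Rightarrow> nat \<Rightarrow> nat \<Rightarrow> 'a" where
  "unit_vec R n j = (\<lambda>i\<in>{..<n}. if i = j then \<one>\<^bsub>R\<^esub> else \<zero>\<^bsub>R\<^esub>)"

definition right_linear ::
  "('a, 'm) ring_scheme \<Rightarrow> nat \<Rightarrow> nat \<Rightarrow> ((nat \<Rightarrow> 'a) \<Rightarrow> (nat \<Rightarrow> 'a)) \<Rightarrow> bool" where
  "right_linear R m n h \<longleftrightarrow>
     h \<in> hom (add_monoid (free_right_module R m)) (add_monoid (free_right_module R n)) \<and>
     (\<forall>a\<in>carrier R. \<forall>x\<in>carrier (free_right_module R m).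
        h (a \<odot>\<^bsub>free_right_module R m\<^esub> x) = a \<odot>\<^bsub>free_right_module R n\<^esub> h x)"

lemma unit_vec_closed: "ring R \<Longrightarrow> unit_vec R n j \<in> carrier (free_right_module R n)"
  by (auto simp: unit_vec_def free_right_module_def ring.is_monoid monoid.one_closed
      ring.ring_simprules(2))

text \<open>The vector \<open>x\<close> is the sum of the \<open>e_j x_j\<close>, where \<open>e_j\<close> are the unit vectors. The induction
  runs over the truncations of \<open>x\<close> to subsets of its coordinates, which avoids sums in the free
  module.\<close>

lemma (in ring) right_linear_coordinates:
  assumes h: "right_linear R m n h"
    and x: "x \<in> carrier (free_right_module R m)" and i: "i < n"
  shows "h x i = (\<Oplus>j\<in>{..<m}. h (unit_vec R m j) i \<otimes> x j)"
proof -
  let ?M = "free_right_module R m" and ?N = "free_right_module R n"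
  have add: "h (y \<oplus>\<^bsub>?M\<^esub> z) = h y \<oplus>\<^bsub>?N\<^esub> h z" if "y \<in> carrier ?M" "z \<in> carrier ?M" for y z
    using h that by (auto simp: right_linear_def hom_def)
  have smult: "h (a \<odot>\<^bsub>?M\<^esub> y) = a \<odot>\<^bsub>?N\<^esub> h y" if "a \<in> carrier R" "y \<in> carrier ?M" for a y
    using h that by (auto simp: right_linear_def)
  have closed: "h y \<in> carrier ?N" if "y \<in> carrier ?M" for y
    using h that by (auto simp: right_linear_def hom_def)
  have comp: "h y i \<in> carrier R" if "y \<in> carrier ?M" for y
    using closed[OF that] i by (auto simp: free_right_module_def)
  have xj: "x j \<in> carrier R" if "j < m" for j using x that by (auto simp: free_right_module_def)
  define part where "part S = (\<lambda>j\<in>{..<m}. if j \<in> S then x j else \<zero>)" for S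
  have part: "part S \<in> carrier ?M" for S using xj by (auto simp: part_def free_right_module_def)
  have "h (part S) i = (\<Oplus>j\<in>S. h (unit_vec R m j) i \<otimes> x j)" if "finite S" "S \<subseteq> {..<m}" for S
    using that
  proof (induction S rule: finite_induct)
    case empty
    \<comment> \<open>\<open>part {}\<close> is zero, and applying \<open>h\<close> to \<open>0 + 0 = 0\<close> gives \<open>h 0 + h 0 = h 0\<close>, which cancels\<close>
    have "part {} \<oplus>\<^bsub>?M\<^esub> part {} = part {}"
      by (auto simp: part_def free_right_module_def)
    from arg_cong[OF this, of h] add[OF part part, of "{}" "{}"]
    have "h (part {}) \<oplus>\<^bsub>?N\<^esub> h (part {}) = h (part {})" by simp
    from fun_cong[OF this, of i] i have "h (part {}) i \<oplus> h (part {}) i = h (part {}) i"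
      by (simp add: free_right_module_def)
    then show ?case using comp[OF part[of "{}"]] by simp
  next
    case (insert j S)
    let ?e = "unit_vec R m j"
    have e: "?e \<in> carrier ?M" using unit_vec_closed ring_axioms by blast
    have j: "j < m" using insert by simp
    have ex: "x j \<odot>\<^bsub>?M\<^esub> ?e \<in> carrier ?M"
      using e xj[OF j] by (auto simp: free_right_module_def)
    have "part (insert j S) = (x j \<odot>\<^bsub>?M\<^esub> ?e) \<oplus>\<^bsub>?M\<^esub> part S"
      using insert.hyps xj j by (auto simp: part_def unit_vec_def free_right_module_def fun_eq_iff l_null)
    then have "h (part (insert j S)) = (x j \<odot>\<^bsub>?N\<^esub> h ?e) \<oplus>\<^bsub>?N\<^esub> h (part S)"
      using add[OF ex part] smult[OF xj[OF j] e] by simp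
    then have "h (part (insert j S)) i = h ?e i \<otimes> x j \<oplus> h (part S) i"
      using i by (simp add: free_right_module_def)
    then show ?case
      using insert xj comp[OF unit_vec_closed[OF ring_axioms]] by (subst finsum_insert) auto
  qed
  from this[of "{..<m}"] have "h (part {..<m}) i = (\<Oplus>j\<in>{..<m}. h (unit_vec R m j) i \<otimes> x j)" by simp
  moreover have "part {..<m} = x"
    using x by (auto simp: part_def free_right_module_def fun_eq_iff PiE_def extensional_def)
  ultimately show ?thesis by simp
qed

lemma right_module_iso_right_linear:
  assumes "h \<in> right_module_iso R (free_right_module R m) (free_right_module R n)"
  shows "right_linear R m n h"
    and "bij_betw h (carrier (free_right_module R m)) (carrier (free_right_module R n))"
  using assms by (auto simp: right_module_iso_def right_linear_def iso_def)

lemma (in ring) right_linear_inv: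
  assumes h: "right_linear R m n h"
    and bij: "bij_betw h (carrier (free_right_module R m)) (carrier (free_right_module R n))"
  shows "right_linear R n m (inv_into (carrier (free_right_module R m)) h)"
proof -
  let ?M = "free_right_module R m" and ?N = "free_right_module R n"
  let ?g = "inv_into (carrier ?M) h"
  have g: "?g y \<in> carrier ?M" "h (?g y) = y" if "y \<in> carrier ?N" for y
    using bij that bij_betw_inv_into_right[OF bij] bij_betw_apply[OF bij_betw_inv_into[OF bij]] by auto
  have eq: "?g y = x" if "x \<in> carrier ?M" "h x = y" for x y
    using bij that by (auto simp: bij_betw_def)
  have addM: "y \<oplus>\<^bsub>?M\<^esub> z \<in> carrier ?M" if "y \<in> carrier ?M" "z \<in> carrier ?M" for y z
    using that by (auto simp: free_right_module_def)
  have smM: "a \<odot>\<^bsub>?M\<^esub> y \<in> carrier ?M" if "y \<in> carrier ?M" "a \<in> carrier R" for y a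
    using that by (auto simp: free_right_module_def)
  have "?g (y \<oplus>\<^bsub>?N\<^esub> z) = ?g y \<oplus>\<^bsub>?M\<^esub> ?g z" if "y \<in> carrier ?N" "z \<in> carrier ?N" for y z
    using h that g[OF that(1)] g[OF that(2)] by (intro eq addM) (auto simp: right_linear_def hom_def)
  moreover have "?g (a \<odot>\<^bsub>?N\<^esub> y) = a \<odot>\<^bsub>?M\<^esub> ?g y" if "y \<in> carrier ?N" "a \<in> carrier R" for y a
    using h that g[OF that(1)] by (intro eq smM) (auto simp: right_linear_def)
  ultimately show ?thesis using g by (auto simp: right_linear_def hom_def)
qed

text \<open>A unital ring homomorphism \<open>\<rho>\<close> from \<open>R\<close> to the ring of matrices over \<open>K\<close> whose rows and columns
  are indexed by a finite nonempty set \<open>V\<close>. It is given by its matrix entries, so that the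
  matrix ring need not be constructed.\<close>

locale matrix_representation = R: ring R + K: field K
  for R :: "('a, 'm) ring_scheme" (structure) and K :: "('k, 'n) ring_scheme" +
  fixes V :: "'v set" and \<rho> :: "'a \<Rightarrow> 'v \<Rightarrow> 'v \<Rightarrow> 'k"
  assumes finite_V: "finite V" and V_nonempty: "V \<noteq> {}"
    and rep_closed: "\<And>a x y. a \<in> carrier R \<Longrightarrow> x \<in> V \<Longrightarrow> y \<in> V \<Longrightarrow> \<rho> a x y \<in> carrier K"
    and rep_add: "\<And>a b x y. a \<in> carrier R \<Longrightarrow> b \<in> carrier R \<Longrightarrow> x \<in> V \<Longrightarrow> y \<in> V \<Longrightarrow>
      \<rho> (a \<oplus> b) x y = \<rho> a x y \<oplus>\<^bsub>K\<^esub> \<rho> b x y"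
    and rep_mult: "\<And>a b x y. a \<in> carrier R \<Longrightarrow> b \<in> carrier R \<Longrightarrow> x \<in> V \<Longrightarrow> y \<in> V \<Longrightarrow>
      \<rho> (a \<otimes> b) x y = (\<Oplus>\<^bsub>K\<^esub>z\<in>V. \<rho> a x z \<otimes>\<^bsub>K\<^esub> \<rho> b z y)"
    and rep_one: "\<And>x y. x \<in> V \<Longrightarrow> y \<in> V \<Longrightarrow> \<rho> \<one> x y = (if x = y then \<one>\<^bsub>K\<^esub> else \<zero>\<^bsub>K\<^esub>)"
begin

lemma rep_zero: "x \<in> V \<Longrightarrow> y \<in> V \<Longrightarrow> \<rho> \<zero> x y = \<zero>\<^bsub>K\<^esub>"
  using rep_add[of \<zero> \<zero> x y] rep_closed[of \<zero> x y] by simp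

lemma rep_finsum:
  assumes "finite J" "\<And>j. j \<in> J \<Longrightarrow> f j \<in> carrier R" "x \<in> V" "y \<in> V"
  shows "\<rho> (\<Oplus>j\<in>J. f j) x y = (\<Oplus>\<^bsub>K\<^esub>j\<in>J. \<rho> (f j) x y)"
  using assms
proof (induction J rule: finite_induct)
  case empty
  then show ?case by (simp add: rep_zero)
next
  case (insert j J)
  then show ?case
    by (simp add: R.finsum_insert K.finsum_insert rep_add rep_closed Pi_def)
qed

text \<open>Preimages of the unit vectors form the columns of a right inverse \<open>B\<close> of the \<open>n \<times> m\<close> matrix
  \<open>A\<close> of \<open>h\<close>. Replacing each entry of \<open>A\<close> and \<open>B\<close> by its image under \<open>\<rho>\<close> gives block matrices
  over \<open>K\<close> of size \<open>n |V| \<times> m |V|\<close> and \<open>m |V| \<times> n |V|\<close> whose product is the identity, and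
  linear algebra over \<open>K\<close> applies.\<close>

lemma right_linear_onto_rank_le:
  assumes h: "right_linear R m n h"
    and onto: "carrier (free_right_module R n) \<subseteq> h ` carrier (free_right_module R m)"
  shows "n \<le> m"
proof -
  define y where "y k = inv_into (carrier (free_right_module R m)) h (unit_vec R n k)" for k
  have "unit_vec R n k \<in> h ` carrier (free_right_module R m)" for k
    using onto unit_vec_closed[OF R.ring_axioms] by blast
  then have y: "y k \<in> carrier (free_right_module R m)" "h (y k) = unit_vec R n k" for k
    unfolding y_def using inv_into_into f_inv_into_f by metis+
  define A where "A i j = h (unit_vec R m j) i" for i j
  define B where "B j k = y k j" for j k
  have A: "A i j \<in> carrier R" if "i < n" for i j
  proof -
    have "h (unit_vec R m j) \<in> carrier (free_right_module R n)"
      using h unit_vec_closed[OF R.ring_axioms, of m j] by (auto simp: right_linear_def hom_def)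
    then show ?thesis using that by (auto simp: A_def free_right_module_def)
  qed
  have B: "B j k \<in> carrier R" if "j < m" for j k
    using y that by (auto simp: B_def free_right_module_def)
  have AB: "(\<Oplus>j\<in>{..<m}. A i j \<otimes> B j k) = (if i = k then \<one> else \<zero>)" if "i < n" for i k
    using R.right_linear_coordinates[OF h y(1) that, of k] y(2)[of k] that
    by (simp add: A_def B_def unit_vec_def)
  have "card ({..<n} \<times> V) \<le> card ({..<m} \<times> V)"
  proof (rule K.left_invertible_matrix_card_le)
    fix p p' :: "nat \<times> 'v"
    assume p: "p \<in> {..<n} \<times> V" and p': "p' \<in> {..<n} \<times> V"
    obtain i x where ix: "p = (i, x)" "i < n" "x \<in> V" using p by auto
    obtain k z where kz: "p' = (k, z)" "k < n" "z \<in> V" using p' by auto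
    have "(\<Oplus>\<^bsub>K\<^esub>q\<in>{..<m} \<times> V. \<rho> (A i (fst q)) x (snd q) \<otimes>\<^bsub>K\<^esub> \<rho> (B (fst q) k) (snd q) z) =
        (\<Oplus>\<^bsub>K\<^esub>j\<in>{..<m}. \<Oplus>\<^bsub>K\<^esub>t\<in>V. \<rho> (A i j) x t \<otimes>\<^bsub>K\<^esub> \<rho> (B j k) t z)"
      using finite_V A B ix kz rep_closed by (intro K.finsum_Times) auto
    also have "\<dots> = (\<Oplus>\<^bsub>K\<^esub>j\<in>{..<m}. \<rho> (A i j \<otimes> B j k) x z)"
      using A B ix kz by (intro K.finsum_cong') (auto simp: rep_mult rep_closed)
    also have "\<dots> = \<rho> (\<Oplus>j\<in>{..<m}. A i j \<otimes> B j k) x z"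
      using A B ix kz by (intro rep_finsum[symmetric]) auto
    also have "\<dots> = (if p = p' then \<one>\<^bsub>K\<^esub> else \<zero>\<^bsub>K\<^esub>)"
      using ix kz AB rep_one rep_zero by auto
    finally show "(\<Oplus>\<^bsub>K\<^esub>q\<in>{..<m} \<times> V. \<rho> (A (fst p) (fst q)) (snd p) (snd q) \<otimes>\<^bsub>K\<^esub>
        \<rho> (B (fst q) (fst p')) (snd q) (snd p')) = (if p = p' then \<one>\<^bsub>K\<^esub> else \<zero>\<^bsub>K\<^esub>)"
      using ix kz by simp
  qed (use finite_V A B rep_closed in auto)
  then show ?thesis using finite_V V_nonempty by (simp add: card_gt_0_iff)
qed

lemma IBN: "IBN R"
  unfolding IBN_def
proof (intro allI impI)
  fix m n
  assume "right_module_iso R (free_right_module R m) (free_right_module R n) \<noteq> {}"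
  then obtain h where "h \<in> right_module_iso R (free_right_module R m) (free_right_module R n)" by auto
  note h = right_module_iso_right_linear[OF this]
  show "m = n"
  proof (rule antisym)
    show "n \<le> m" using right_linear_onto_rank_le[OF h(1)] h(2) by (auto simp: bij_betw_def)
    show "m \<le> n"
      using right_linear_onto_rank_le[OF R.right_linear_inv[OF h]] bij_betw_inv_into[OF h(2)]
      by (auto simp: bij_betw_def)
  qed
qed

end

section \<open>Leavitt relations contradict graded invariant basis number\<close>

text \<open>A graded isomorphism is in particular an isomorphism of the underlying free modules.\<close>

lemma IBN_imp_gr_IBN: "IBN R \<Longrightarrow> gr_IBN R A"
  unfolding IBN_def gr_IBN_def by blast

text \<open>Elements with \<open>b_i a_j = \<delta>_ij\<close> and \<open>\<Sum> a_i b_i = 1\<close> make \<open>x \<mapsto> (b_i x)_i\<close> an isomorphism from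
  \<open>R\<close> to \<open>R^d\<close>, with inverse \<open>(y_i)_i \<mapsto> \<Sum> a_i y_i\<close>. It preserves degrees if the copies of \<open>R\<close> in the
  target are shifted by the degrees \<open>\<beta> i\<close> of the \<open>b i\<close>.\<close>

lemma (in ring) Leavitt_relations_imp_not_gr_IBN:
  fixes A :: "'c::ab_group_add \<Rightarrow> 'a set" and d :: nat
  assumes d: "2 \<le> d"
    and a: "\<And>i. i < d \<Longrightarrow> a i \<in> carrier R" and b: "\<And>i. i < d \<Longrightarrow> b i \<in> carrier R"
    and ba: "\<And>i j. i < d \<Longrightarrow> j < d \<Longrightarrow> b i \<otimes> a j = (if i = j then \<one> else \<zero>)"
    and ab: "(\<Oplus>i\<in>{..<d}. a i \<otimes> b i) = \<one>"
    and shift: "\<And>i \<gamma> x. i < d \<Longrightarrow> x \<in> A \<gamma> \<Longrightarrow> b i \<otimes> x \<in> A (\<beta> i + \<gamma>)"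
  shows "\<not> gr_IBN R A"
proof -
  let ?M = "free_right_module R 1" and ?N = "free_right_module R d"
  define h where "h x = (\<lambda>i\<in>{..<d}. b i \<otimes> x 0)" for x :: "nat \<Rightarrow> 'a"
  define g where "g y = (\<lambda>i\<in>{..<1::nat}. \<Oplus>j\<in>{..<d}. a j \<otimes> y j)" for y :: "nat \<Rightarrow> 'a"
  have hM: "h x \<in> carrier ?N" if "x \<in> carrier ?M" for x
    using that b by (auto simp: h_def free_right_module_def)
  have gN: "g y \<in> carrier ?M" if "y \<in> carrier ?N" for y
    using that a by (auto simp: g_def free_right_module_def intro!: finsum_closed)
  have gh: "g (h x) = x" if "x \<in> carrier ?M" for x
  proof -
    have x0: "x 0 \<in> carrier R" using that by (auto simp: free_right_module_def)
    have "(\<Oplus>j\<in>{..<d}. a j \<otimes> h x j) = (\<Oplus>j\<in>{..<d}. (a j \<otimes> b j) \<otimes> x 0)"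
      using a b x0 by (intro finsum_cong') (auto simp: h_def m_assoc)
    also have "\<dots> = x 0" using a b x0 ab by (subst finsum_ldistr[symmetric]) auto
    finally show ?thesis
      using that by (auto simp: g_def free_right_module_def fun_eq_iff PiE_def extensional_def)
  qed
  have hg: "h (g y) = y" if "y \<in> carrier ?N" for y
  proof -
    have yj: "y j \<in> carrier R" if "j < d" for j using \<open>y \<in> _\<close> that by (auto simp: free_right_module_def)
    have "b i \<otimes> (\<Oplus>j\<in>{..<d}. a j \<otimes> y j) = y i" if i: "i < d" for i
    proof -
      have "b i \<otimes> (\<Oplus>j\<in>{..<d}. a j \<otimes> y j) = (\<Oplus>j\<in>{..<d}. b i \<otimes> (a j \<otimes> y j))"
        using a b yj i by (subst finsum_rdistr) auto
      also have "\<dots> = (\<Oplus>j\<in>{..<d}. if j = i then y j else \<zero>)"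
        using a b yj i ba by (intro finsum_cong') (auto simp: m_assoc[symmetric])
      also have "\<dots> = y i" using i yj by (intro finsum_delta) auto
      finally show ?thesis .
    qed
    then show ?thesis
      using that by (auto simp: g_def h_def free_right_module_def fun_eq_iff PiE_def extensional_def)
  qed
  have "bij_betw h (carrier ?M) (carrier ?N)"
    by (rule bij_betw_byWitness[of _ g]) (use gh hg hM gN in auto)
  moreover have "h \<in> hom (add_monoid ?M) (add_monoid ?N)"
  proof (rule homI)
    fix x y assume "x \<in> carrier (add_monoid ?M)" "y \<in> carrier (add_monoid ?M)"
    then have "x 0 \<in> carrier R" "y 0 \<in> carrier R" by (auto simp: free_right_module_def)
    then show "h (x \<otimes>\<^bsub>add_monoid ?M\<^esub> y) = h x \<otimes>\<^bsub>add_monoid ?N\<^esub> h y"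
      using b by (auto simp: h_def free_right_module_def r_distr)
  qed (use hM in auto)
  moreover have "h (c \<odot>\<^bsub>?M\<^esub> x) = c \<odot>\<^bsub>?N\<^esub> h x" if "c \<in> carrier R" "x \<in> carrier ?M" for c x
  proof -
    have "x 0 \<in> carrier R" using that by (auto simp: free_right_module_def)
    then show ?thesis using that b by (auto simp: h_def free_right_module_def m_assoc)
  qed
  ultimately have iso: "h \<in> right_module_iso R ?M ?N"
    by (auto simp: right_module_iso_def iso_def)
  have "h ` direct_sum_grading A 1 (\<lambda>_. 0) \<gamma> \<subseteq> direct_sum_grading A d \<beta> \<gamma>" for \<gamma>
  proof (rule image_subsetI)
    fix x assume "x \<in> direct_sum_grading A 1 (\<lambda>_. 0) \<gamma>"
    then have "x 0 \<in> A \<gamma>"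
      using PiE_mem[of x "{..<1}" "\<lambda>_. A \<gamma>" 0] by (simp add: direct_sum_grading_def shift_grading_def)
    then show "h x \<in> direct_sum_grading A d \<beta> \<gamma>"
      unfolding direct_sum_grading_def shift_grading_def h_def by (simp add: shift)
  qed
  with iso have graded_iso: "\<exists>h\<in>right_module_iso R ?M ?N.
      \<forall>\<gamma>. h ` direct_sum_grading A 1 (\<lambda>_. 0) \<gamma> \<subseteq> direct_sum_grading A d \<beta> \<gamma>"
    by (intro bexI[of _ h] allI)
  show ?thesis
  proof
    assume "gr_IBN R A"
    then have "1 = d"
      unfolding gr_IBN_def using graded_iso d
      by (elim allE[of _ "1::nat"] allE[of _ d] allE[of _ "\<lambda>_. 0"] allE[of _ \<beta>]) simp
    with d show False by simp
  qed
qed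

section \<open>Free algebras\<close>

abbreviation free_monom :: "('k, 'm) ring_scheme \<Rightarrow> 'k \<Rightarrow> 'x list \<Rightarrow> 'x list \<Rightarrow> 'k" where
  "free_monom K k w \<equiv> (\<lambda>u. if u = w then k else \<zero>\<^bsub>K\<^esub>)"

lemma free_algebra_carrierI:
  assumes "\<And>w. f w \<in> carrier K" "finite {w. f w \<noteq> \<zero>\<^bsub>K\<^esub>}" "\<And>w. f w \<noteq> \<zero>\<^bsub>K\<^esub> \<Longrightarrow> w \<in> lists X"
  shows "f \<in> carrier (free_algebra K X)"
  using assms by (auto simp: free_algebra_def)

lemma free_algebra_carrierD:
  assumes "f \<in> carrier (free_algebra K X)"
  shows "f w \<in> carrier K" "finite {w. f w \<noteq> \<zero>\<^bsub>K\<^esub>}" "f w \<noteq> \<zero>\<^bsub>K\<^esub> \<Longrightarrow> w \<in> lists X"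
  using assms by (auto simp: free_algebra_def)

lemma free_algebra_simps:
  "\<zero>\<^bsub>free_algebra K X\<^esub> = (\<lambda>w. \<zero>\<^bsub>K\<^esub>)"
  "\<one>\<^bsub>free_algebra K X\<^esub> = free_monom K \<one>\<^bsub>K\<^esub> []"
  "(f \<oplus>\<^bsub>free_algebra K X\<^esub> g) w = f w \<oplus>\<^bsub>K\<^esub> g w"
  "(f \<otimes>\<^bsub>free_algebra K X\<^esub> g) w = (\<Oplus>\<^bsub>K\<^esub>i\<in>{..length w}. f (take i w) \<otimes>\<^bsub>K\<^esub> g (drop i w))"
  by (auto simp: free_algebra_def)

context ring
begin

definition conv :: "('x list \<Rightarrow> 'a) \<Rightarrow> ('x list \<Rightarrow> 'a) \<Rightarrow> 'x list \<Rightarrow> 'a" where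
  "conv f g w = (\<Oplus>i\<in>{..length w}. f (take i w) \<otimes> g (drop i w))"

lemma mult_free_algebra: "f \<otimes>\<^bsub>free_algebra R X\<^esub> g = conv f g"
  by (rule ext) (simp add: free_algebra_simps conv_def)

lemma add_free_algebra: "f \<oplus>\<^bsub>free_algebra R X\<^esub> g = (\<lambda>w. f w \<oplus> g w)"
  by (rule ext) (simp add: free_algebra_simps)

lemma conv_Nil: "f [] \<in> carrier R \<Longrightarrow> g [] \<in> carrier R \<Longrightarrow> conv f g [] = f [] \<otimes> g []"
  by (simp add: conv_def finsum_0)

text \<open>Splitting off the cut before the first letter turns the convolution into a recursion along the
  word. With it associativity and the product of monomials become inductions on words, free of
  index manipulations.\<close>

lemma conv_Cons:
  assumes "\<And>w. f w \<in> carrier R" "\<And>w. g w \<in> carrier R"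
  shows "conv f g (x # w) = f [] \<otimes> g (x # w) \<oplus> conv (\<lambda>u. f (x # u)) g w"
  unfolding conv_def using assms by (simp add: finsum_Suc2 a_comm del: add.finprod_Suc finsum_Suc)

lemma conv_closed:
  "(\<And>w. f w \<in> carrier R) \<Longrightarrow> (\<And>w. g w \<in> carrier R) \<Longrightarrow> conv f g w \<in> carrier R"
  unfolding conv_def by (intro finsum_closed) auto

lemma conv_add_left:
  assumes "\<And>w. f w \<in> carrier R" "\<And>w. g w \<in> carrier R" "\<And>w. h w \<in> carrier R"
  shows "conv (\<lambda>w. f w \<oplus> g w) h w = conv f h w \<oplus> conv g h w"
  unfolding conv_def using assms
  by (subst finsum_addf[symmetric]) (auto simp: l_distr intro!: finsum_cong')

lemma conv_add_right:
  assumes "\<And>w. f w \<in> carrier R" "\<And>w. g w \<in> carrier R" "\<And>w. h w \<in> carrier R"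
  shows "conv f (\<lambda>w. g w \<oplus> h w) w = conv f g w \<oplus> conv f h w"
  unfolding conv_def using assms
  by (subst finsum_addf[symmetric]) (auto simp: r_distr intro!: finsum_cong')

lemma conv_scale_left:
  assumes "k \<in> carrier R" "\<And>w. f w \<in> carrier R" "\<And>w. g w \<in> carrier R"
  shows "conv (\<lambda>w. k \<otimes> f w) g w = k \<otimes> conv f g w"
  unfolding conv_def using assms
  by (subst finsum_rdistr) (auto simp: m_assoc intro!: finsum_cong')

lemma conv_zero_left: "(\<And>w. g w \<in> carrier R) \<Longrightarrow> conv (\<lambda>w. \<zero>) g w = \<zero>"
  unfolding conv_def by simp

lemma conv_assoc:
  assumes "\<And>w. f w \<in> carrier R" "\<And>w. g w \<in> carrier R" "\<And>w. h w \<in> carrier R"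
  shows "conv (conv f g) h w = conv f (conv g h) w"
  using assms(1)
proof (induction w arbitrary: f)
  case Nil
  then show ?case using assms by (simp add: conv_Nil conv_closed m_assoc)
next
  case (Cons x w)
  let ?f = "\<lambda>u. f (x # u)" and ?g = "\<lambda>u. g (x # u)"
  have cl: "f u \<in> carrier R" "g u \<in> carrier R" "h u \<in> carrier R"
    "conv f g u \<in> carrier R" "conv g h u \<in> carrier R"
    "conv ?f g u \<in> carrier R" "conv ?g h u \<in> carrier R" "conv ?f (conv g h) u \<in> carrier R" for u
    using Cons.prems assms(2,3) by (auto intro!: conv_closed)
  have "conv (conv f g) h (x # w) =
      f [] \<otimes> g [] \<otimes> h (x # w) \<oplus> conv (\<lambda>u. f [] \<otimes> g (x # u) \<oplus> conv ?f g u) h w"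
    using cl by (simp add: conv_Cons conv_Nil)
  also have "conv (\<lambda>u. f [] \<otimes> g (x # u) \<oplus> conv ?f g u) h w =
      f [] \<otimes> conv ?g h w \<oplus> conv ?f (conv g h) w"
    using cl by (simp add: conv_add_left conv_scale_left Cons.IH)
  also have "f [] \<otimes> g [] \<otimes> h (x # w) \<oplus> (f [] \<otimes> conv ?g h w \<oplus> conv ?f (conv g h) w) =
      f [] \<otimes> (g [] \<otimes> h (x # w) \<oplus> conv ?g h w) \<oplus> conv ?f (conv g h) w"
    using cl by (simp add: r_distr m_assoc a_assoc)
  also have "\<dots> = conv f (conv g h) (x # w)"
    using cl by (simp add: conv_Cons)
  finally show ?case .
qed

lemma conv_monom_Nil:
  assumes "k \<in> carrier R" "\<And>w. g w \<in> carrier R"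
  shows "conv (free_monom R k []) g w = k \<otimes> g w"
  using assms by (cases w) (simp_all add: conv_Nil conv_Cons conv_zero_left)

lemma conv_Nil_monom:
  assumes "k \<in> carrier R" "\<And>w. f w \<in> carrier R"
  shows "conv f (free_monom R k []) w = f w \<otimes> k"
  using assms(2)
proof (induction w arbitrary: f)
  case Nil
  then show ?case using assms by (simp add: conv_Nil)
next
  case (Cons x w)
  then show ?case using assms by (simp add: conv_Cons)
qed

lemma conv_monom_monom:
  assumes "k \<in> carrier R" "l \<in> carrier R"
  shows "conv (free_monom R k u) (free_monom R l v) = free_monom R (k \<otimes> l) (u @ v)"
proof
  show "conv (free_monom R k u) (free_monom R l v) w = free_monom R (k \<otimes> l) (u @ v) w" for w
  proof (induction u arbitrary: w)
    case Nil
    then show ?case using assms by (simp add: conv_monom_Nil)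
  next
    case (Cons x u)
    show ?case
    proof (cases w)
      case Nil
      then show ?thesis using assms by (simp add: conv_Nil)
    next
      case (Cons y w')
      then show ?thesis using assms Cons.IH[of w']
        by (cases "y = x") (simp_all add: conv_Cons conv_zero_left)
    qed
  qed
qed

lemma conv_nonzeroD:
  assumes "conv f g w \<noteq> \<zero>" "\<And>w. f w \<in> carrier R" "\<And>w. g w \<in> carrier R"
  obtains u v where "w = u @ v" "f u \<noteq> \<zero>" "g v \<noteq> \<zero>"
proof -
  have "\<exists>i\<in>{..length w}. f (take i w) \<otimes> g (drop i w) \<noteq> \<zero>"
    using assms(1) add.finprod_one_eqI[of "{..length w}" "\<lambda>i. f (take i w) \<otimes> g (drop i w)"] unfolding conv_def by blast
  then obtain i where "f (take i w) \<otimes> g (drop i w) \<noteq> \<zero>" by blast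
  then have "f (take i w) \<noteq> \<zero>" "g (drop i w) \<noteq> \<zero>" using assms(2,3) by auto
  then show ?thesis using that[of "take i w" "drop i w"] by simp
qed

lemma conv_in_free_algebra:
  assumes f: "f \<in> carrier (free_algebra R X)" and g: "g \<in> carrier (free_algebra R X)"
  shows "conv f g \<in> carrier (free_algebra R X)"
proof (rule free_algebra_carrierI)
  note F = free_algebra_carrierD[OF f] and G = free_algebra_carrierD[OF g]
  show "conv f g w \<in> carrier R" for w using F G by (intro conv_closed) auto
  have "{w. conv f g w \<noteq> \<zero>} \<subseteq> (\<lambda>(u, v). u @ v) ` ({u. f u \<noteq> \<zero>} \<times> {v. g v \<noteq> \<zero>})"
    using F(1) G(1) by (auto elim!: conv_nonzeroD)
  then show "finite {w. conv f g w \<noteq> \<zero>}"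
    by (rule finite_subset) (use F(2) G(2) in auto)
  show "w \<in> lists X" if "conv f g w \<noteq> \<zero>" for w
    using conv_nonzeroD[OF that F(1) G(1)] F(3) G(3) by (metis append_in_lists_conv)
qed

lemma monom_in_free_algebra:
  "k \<in> carrier R \<Longrightarrow> w \<in> lists X \<Longrightarrow> free_monom R k w \<in> carrier (free_algebra R X)"
  by (rule free_algebra_carrierI) (auto simp del: in_lists_conv_set split: if_splits)

lemma add_in_free_algebra:
  assumes f: "f \<in> carrier (free_algebra R X)" and g: "g \<in> carrier (free_algebra R X)"
  shows "(\<lambda>w. f w \<oplus> g w) \<in> carrier (free_algebra R X)"
proof (rule free_algebra_carrierI)
  note F = free_algebra_carrierD[OF f] and G = free_algebra_carrierD[OF g]
  have sub: "{w. f w \<oplus> g w \<noteq> \<zero>} \<subseteq> {w. f w \<noteq> \<zero>} \<union> {w. g w \<noteq> \<zero>}" using F G by auto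
  show "finite {w. f w \<oplus> g w \<noteq> \<zero>}" by (rule finite_subset[OF sub]) (use F G in auto)
  show "w \<in> lists X" if "f w \<oplus> g w \<noteq> \<zero>" for w using sub that F(3) G(3) by blast
qed (use free_algebra_carrierD[OF f] free_algebra_carrierD[OF g] in auto)

lemma free_algebra_ring: "ring (free_algebra R X)"
proof (rule ringI)
  let ?F = "free_algebra R X"
  note D = free_algebra_carrierD(1)
  show "abelian_group ?F"
  proof (rule abelian_groupI)
    show "f \<oplus>\<^bsub>?F\<^esub> g \<in> carrier ?F" if "f \<in> carrier ?F" "g \<in> carrier ?F" for f g
      using add_in_free_algebra[OF that] by (simp add: free_algebra_def)
    show "\<zero>\<^bsub>?F\<^esub> \<in> carrier ?F" by (auto simp: free_algebra_def)
    show "\<exists>g\<in>carrier ?F. g \<oplus>\<^bsub>?F\<^esub> f = \<zero>\<^bsub>?F\<^esub>" if f: "f \<in> carrier ?F" for f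
    proof (intro bexI)
      show "(\<lambda>w. \<ominus> f w) \<in> carrier ?F"
      proof (rule free_algebra_carrierI)
        have "{w. \<ominus> f w \<noteq> \<zero>} \<subseteq> {w. f w \<noteq> \<zero>}" by auto
        then show "finite {w. \<ominus> f w \<noteq> \<zero>}"
          using free_algebra_carrierD(2)[OF f] finite_subset by blast
      qed (use free_algebra_carrierD[OF f] in auto)
      show "(\<lambda>w. \<ominus> f w) \<oplus>\<^bsub>?F\<^esub> f = \<zero>\<^bsub>?F\<^esub>"
        using D[OF f] by (auto simp: free_algebra_simps fun_eq_iff l_neg)
    qed
  qed (auto simp: free_algebra_simps fun_eq_iff D a_ac)
  show "monoid ?F"
  proof (rule monoidI)
    show "f \<otimes>\<^bsub>?F\<^esub> g \<in> carrier ?F" if "f \<in> carrier ?F" "g \<in> carrier ?F" for f g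
      using conv_in_free_algebra[OF that] by (simp add: mult_free_algebra)
    show "\<one>\<^bsub>?F\<^esub> \<in> carrier ?F" by (simp add: free_algebra_simps monom_in_free_algebra)
  qed (auto simp: mult_free_algebra fun_eq_iff D conv_assoc free_algebra_simps conv_monom_Nil conv_Nil_monom)
qed (auto simp: mult_free_algebra add_free_algebra fun_eq_iff free_algebra_carrierD(1)[of _ R X]
    conv_add_left conv_add_right)

text \<open>Every element is a finite sum of monomials. The induction only adds monomials from the support of
  the given \<open>f\<close>, so that a property of the support (such as not containing the empty word) is
  available in the induction step.\<close>

lemma free_algebra_induct [consumes 1, case_names zero add]:
  assumes f: "f \<in> carrier (free_algebra R X)"
    and zero: "P (\<lambda>w. \<zero>)"
    and add: "\<And>k w g. k \<in> carrier R \<Longrightarrow> w \<in> lists X \<Longrightarrow> f w \<noteq> \<zero> \<Longrightarrow> g \<in> carrier (free_algebra R X) \<Longrightarrow>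
      P g \<Longrightarrow> P (\<lambda>u. free_monom R k w u \<oplus> g u)"
  shows "P f"
proof -
  note F = free_algebra_carrierD[OF f]
  \<comment> \<open>restrictions of \<open>f\<close> to parts \<open>S\<close> of its support\<close>
  let ?cut = "\<lambda>S w. if w \<in> S then f w else \<zero>"
  have cut: "?cut S \<in> carrier (free_algebra R X)" for S
  proof (rule free_algebra_carrierI)
    have "{w. ?cut S w \<noteq> \<zero>} \<subseteq> {w. f w \<noteq> \<zero>}" by auto
    then show "finite {w. ?cut S w \<noteq> \<zero>}" using F(2) finite_subset by blast
  qed (use F in \<open>auto split: if_splits\<close>)
  have "P (?cut S)" if "finite S" "S \<subseteq> {w. f w \<noteq> \<zero>}" for S
    using that
  proof (induction S rule: finite_induct)
    case empty
    then show ?case using zero by simp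
  next
    case (insert w S)
    have "?cut (insert w S) = (\<lambda>u. free_monom R (f w) w u \<oplus> ?cut S u)"
      using insert.hyps F by auto
    moreover have "P (\<lambda>u. free_monom R (f w) w u \<oplus> ?cut S u)"
      by (rule add) (use F cut insert in auto)
    ultimately show ?case by simp
  qed
  from this[OF F(2) order_refl] have "P (?cut {w. f w \<noteq> \<zero>})" .
  moreover have "?cut {w. f w \<noteq> \<zero>} = f" by auto
  ultimately show ?thesis by simp
qed

end

section \<open>Evaluation of free algebras at matrices\<close>

primrec word_matrix ::
  "('k, 'm) ring_scheme \<Rightarrow> 'v set \<Rightarrow> ('x \<Rightarrow> 'v \<Rightarrow> 'v \<Rightarrow> 'k) \<Rightarrow> 'x list \<Rightarrow> 'v \<Rightarrow> 'v \<Rightarrow> 'k" where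
  "word_matrix K V M [] = (\<lambda>x y. if x = y then \<one>\<^bsub>K\<^esub> else \<zero>\<^bsub>K\<^esub>)"
| "word_matrix K V M (g # w) = (\<lambda>x z. \<Oplus>\<^bsub>K\<^esub>y\<in>V. M g x y \<otimes>\<^bsub>K\<^esub> word_matrix K V M w y z)"

definition eval_matrix ::
  "('k, 'm) ring_scheme \<Rightarrow> 'v set \<Rightarrow> ('x \<Rightarrow> 'v \<Rightarrow> 'v \<Rightarrow> 'k) \<Rightarrow> ('x list \<Rightarrow> 'k) \<Rightarrow> 'v \<Rightarrow> 'v \<Rightarrow> 'k" where
  "eval_matrix K V M f x y =
     (\<Oplus>\<^bsub>K\<^esub>w\<in>{w. f w \<noteq> \<zero>\<^bsub>K\<^esub>}. f w \<otimes>\<^bsub>K\<^esub> word_matrix K V M w x y)"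

locale matrix_family = cring K for K :: "('k, 'm) ring_scheme" (structure) +
  fixes X :: "'x set" and V :: "'v set" and M :: "'x \<Rightarrow> 'v \<Rightarrow> 'v \<Rightarrow> 'k"
  assumes finite_V: "finite V"
    and M_closed: "\<And>g x y. M g x y \<in> carrier K"
begin

abbreviation "W \<equiv> word_matrix K V M"
abbreviation "ev \<equiv> eval_matrix K V M"
abbreviation "F \<equiv> free_algebra K X"

lemma word_matrix_closed: "W w x y \<in> carrier K"
  by (induction w arbitrary: x) (auto simp: M_closed intro!: finsum_closed)

lemma word_matrix_append:
  "x \<in> V \<Longrightarrow> W (u @ v) x z = (\<Oplus>y\<in>V. W u x y \<otimes> W v y z)"
proof (induction u arbitrary: x)
  case Nil
  have "(\<Oplus>y\<in>V. W [] x y \<otimes> W v y z) = (\<Oplus>y\<in>V. if y = x then W v y z else \<zero>)"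
    by (intro finsum_cong') (auto simp: word_matrix_closed)
  then show ?case using Nil finite_V by (simp add: finsum_delta word_matrix_closed)
next
  case (Cons g u)
  note cl = M_closed word_matrix_closed
  have "W ((g # u) @ v) x z = (\<Oplus>t\<in>V. M g x t \<otimes> (\<Oplus>y\<in>V. W u t y \<otimes> W v y z))"
    using Cons.IH cl by (auto intro!: finsum_cong' finsum_closed)
  also have "\<dots> = (\<Oplus>t\<in>V. \<Oplus>y\<in>V. M g x t \<otimes> W u t y \<otimes> W v y z)"
    using cl finite_V by (intro finsum_cong') (auto simp: finsum_rdistr m_assoc intro!: finsum_cong' finsum_closed)
  also have "\<dots> = (\<Oplus>y\<in>V. \<Oplus>t\<in>V. M g x t \<otimes> W u t y \<otimes> W v y z)"
    using cl finite_V by (intro finsum_swap) auto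
  also have "\<dots> = (\<Oplus>y\<in>V. W (g # u) x y \<otimes> W v y z)"
    using cl finite_V by (intro finsum_cong') (auto simp: finsum_ldistr intro!: finsum_closed)
  finally show ?case .
qed

lemma eval_matrix_superset:
  assumes f: "f \<in> carrier F" and S: "finite S" "{w. f w \<noteq> \<zero>} \<subseteq> S"
  shows "ev f x y = (\<Oplus>w\<in>S. f w \<otimes> W w x y)"
  unfolding eval_matrix_def
  using free_algebra_carrierD[OF f] S word_matrix_closed
  by (intro add.finprod_mono_neutral_cong_left) auto

lemma eval_matrix_closed: "f \<in> carrier F \<Longrightarrow> ev f x y \<in> carrier K"
  unfolding eval_matrix_def
  by (intro finsum_closed) (auto simp: free_algebra_carrierD(1)[of f K X] word_matrix_closed)

lemma eval_matrix_monom: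
  assumes "k \<in> carrier K" "w \<in> lists X"
  shows "ev (free_monom K k w) x y = k \<otimes> W w x y"
proof -
  have "ev (free_monom K k w) x y = (\<Oplus>u\<in>{w}. free_monom K k w u \<otimes> W u x y)"
    by (rule eval_matrix_superset) (use assms monom_in_free_algebra[OF assms] in auto)
  then show ?thesis using assms word_matrix_closed by simp
qed

lemma eval_matrix_add:
  assumes f: "f \<in> carrier F" and g: "g \<in> carrier F"
  shows "ev (\<lambda>w. f w \<oplus> g w) x y = ev f x y \<oplus> ev g x y"
proof -
  note D = free_algebra_carrierD[OF f] free_algebra_carrierD[OF g]
  let ?S = "{w. f w \<noteq> \<zero>} \<union> {w. g w \<noteq> \<zero>}"
  have "ev (\<lambda>w. f w \<oplus> g w) x y = (\<Oplus>w\<in>?S. (f w \<oplus> g w) \<otimes> W w x y)"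
    by (rule eval_matrix_superset[OF add_in_free_algebra[OF f g]]) (use D in auto)
  also have "\<dots> = (\<Oplus>w\<in>?S. f w \<otimes> W w x y \<oplus> g w \<otimes> W w x y)"
    using D word_matrix_closed by (intro finsum_cong') (auto simp: l_distr)
  also have "\<dots> = (\<Oplus>w\<in>?S. f w \<otimes> W w x y) \<oplus> (\<Oplus>w\<in>?S. g w \<otimes> W w x y)"
    using D word_matrix_closed by (intro finsum_addf) auto
  also have "\<dots> = ev f x y \<oplus> ev g x y"
    using D eval_matrix_superset[OF f, of ?S] eval_matrix_superset[OF g, of ?S] by simp
  finally show ?thesis .
qed

lemma eval_matrix_zero: "ev (\<lambda>w. \<zero>) x y = \<zero>"
  by (simp add: eval_matrix_def)

lemma eval_matrix_finsum:
  assumes "finite A" "\<And>i. i \<in> A \<Longrightarrow> f i \<in> carrier F"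
  shows "ev (\<Oplus>\<^bsub>F\<^esub>i\<in>A. f i) x y = (\<Oplus>i\<in>A. ev (f i) x y)"
proof -
  interpret F: ring F by (rule free_algebra_ring)
  show ?thesis
    using assms
  proof (induction A rule: finite_induct)
    case empty
    then show ?case by (simp add: free_algebra_simps eval_matrix_zero)
  next
    case (insert i A)
    then have "(\<Oplus>\<^bsub>F\<^esub>i\<in>insert i A. f i) = (\<lambda>w. f i w \<oplus> (\<Oplus>\<^bsub>F\<^esub>i\<in>A. f i) w)"
      by (simp add: add_free_algebra Pi_def)
    then show ?case
      using insert by (simp add: eval_matrix_add eval_matrix_closed Pi_def F.finsum_closed)
  qed
qed

text \<open>Both sides are bilinear, so it is enough to compare them on monomials, where the claim is
  multiplicativity of \<open>W\<close> on words. Hence the two nested inductions, first on \<open>f\<close> and then on \<open>g\<close>.\<close>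

lemma eval_matrix_mult:
  assumes f: "f \<in> carrier F" and g: "g \<in> carrier F" and x: "x \<in> V"
  shows "ev (f \<otimes>\<^bsub>F\<^esub> g) x z = (\<Oplus>y\<in>V. ev f x y \<otimes> ev g y z)"
  using f
proof (induction f rule: free_algebra_induct)
  case zero
  have "conv (\<lambda>w. \<zero>) g = (\<lambda>w. \<zero>)"
    using free_algebra_carrierD(1)[OF g] by (auto simp: conv_zero_left)
  then show ?case
    using eval_matrix_closed[OF g] by (simp add: mult_free_algebra eval_matrix_zero)
next
  case (add k u f)
  have mu: "free_monom K k u \<in> carrier F" using add by (intro monom_in_free_algebra)
  have monom: "ev (conv (free_monom K k u) g) x z = (\<Oplus>y\<in>V. ev (free_monom K k u) x y \<otimes> ev g y z)"
    using g
  proof (induction g rule: free_algebra_induct)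
    case zero
    have "conv (free_monom K k u) (\<lambda>w. \<zero>) = (\<lambda>w. \<zero>)"
      using free_algebra_carrierD(1)[OF mu] by (auto simp: conv_def)
    then show ?case using eval_matrix_closed[OF mu] by (simp add: eval_matrix_zero)
  next
    case (add l v g)
    have mv: "free_monom K l v \<in> carrier F" using add by (intro monom_in_free_algebra)
    note D = free_algebra_carrierD(1)[OF mu] free_algebra_carrierD(1)[OF mv]
      free_algebra_carrierD(1)[OF \<open>g \<in> _\<close>]
    note E = eval_matrix_closed[OF mu] eval_matrix_closed[OF mv] eval_matrix_closed[OF \<open>g \<in> _\<close>]
    have kl: "k \<in> carrier K" "l \<in> carrier K" "u \<in> lists X" "v \<in> lists X"
      using add \<open>k \<in> carrier K\<close> \<open>u \<in> lists X\<close> by auto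
    have "ev (conv (free_monom K k u) (free_monom K l v)) x z = (k \<otimes> l) \<otimes> W (u @ v) x z"
      using kl by (simp only: conv_monom_monom) (subst eval_matrix_monom, auto)
    also have "\<dots> = (\<Oplus>y\<in>V. (k \<otimes> l) \<otimes> (W u x y \<otimes> W v y z))"
      using x kl word_matrix_closed finite_V by (simp add: word_matrix_append finsum_rdistr)
    also have "\<dots> = (\<Oplus>y\<in>V. ev (free_monom K k u) x y \<otimes> ev (free_monom K l v) y z)"
      using kl word_matrix_closed
      by (intro finsum_cong') (auto simp: eval_matrix_monom m_ac)
    finally have words: "ev (conv (free_monom K k u) (free_monom K l v)) x z =
      (\<Oplus>y\<in>V. ev (free_monom K k u) x y \<otimes> ev (free_monom K l v) y z)" .
    have "conv (free_monom K k u) (\<lambda>w. free_monom K l v w \<oplus> g w) =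
        (\<lambda>w. conv (free_monom K k u) (free_monom K l v) w \<oplus> conv (free_monom K k u) g w)"
      using D by (intro ext conv_add_right) auto
    then have "ev (conv (free_monom K k u) (\<lambda>w. free_monom K l v w \<oplus> g w)) x z =
       ev (conv (free_monom K k u) (free_monom K l v)) x z \<oplus> ev (conv (free_monom K k u) g) x z"
      using conv_in_free_algebra[OF mu mv] conv_in_free_algebra[OF mu \<open>g \<in> _\<close>]
      by (simp add: eval_matrix_add)
    also have "\<dots> = (\<Oplus>y\<in>V. ev (free_monom K k u) x y \<otimes> ev (free_monom K l v) y z \<oplus>
        ev (free_monom K k u) x y \<otimes> ev g y z)"
      using E words add.IH by (subst finsum_addf) auto
    also have "\<dots> = (\<Oplus>y\<in>V. ev (free_monom K k u) x y \<otimes> ev (\<lambda>w. free_monom K l v w \<oplus> g w) y z)"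
      using E mv add by (intro finsum_cong') (auto simp: eval_matrix_add r_distr)
    finally show ?case .
  qed
  note D = free_algebra_carrierD(1)[OF mu] free_algebra_carrierD(1)[OF \<open>f \<in> _\<close>]
    free_algebra_carrierD(1)[OF g]
  note E = eval_matrix_closed[OF mu] eval_matrix_closed[OF g] eval_matrix_closed[OF \<open>f \<in> _\<close>]
  have "conv (\<lambda>w. free_monom K k u w \<oplus> f w) g = (\<lambda>w. conv (free_monom K k u) g w \<oplus> conv f g w)"
    using D by (intro ext conv_add_left) auto
  then have "ev (conv (\<lambda>w. free_monom K k u w \<oplus> f w) g) x z =
       ev (conv (free_monom K k u) g) x z \<oplus> ev (conv f g) x z"
    using conv_in_free_algebra[OF mu g] conv_in_free_algebra[OF \<open>f \<in> _\<close> g]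
    by (simp add: eval_matrix_add)
  also have "\<dots> = (\<Oplus>y\<in>V. ev (free_monom K k u) x y \<otimes> ev g y z \<oplus> ev f x y \<otimes> ev g y z)"
    using E monom add.IH by (subst finsum_addf) (auto simp: mult_free_algebra)
  also have "\<dots> = (\<Oplus>y\<in>V. ev (\<lambda>w. free_monom K k u w \<oplus> f w) x y \<otimes> ev g y z)"
    using E mu add by (intro finsum_cong') (auto simp: eval_matrix_add l_distr)
  finally show ?case by (simp add: mult_free_algebra)
qed

lemma eval_matrix_kernel_ideal: "ideal {f \<in> carrier F. \<forall>x\<in>V. \<forall>y\<in>V. ev f x y = \<zero>} F"
proof -
  interpret F: ring F by (rule free_algebra_ring)
  have add: "ev (f \<oplus>\<^bsub>F\<^esub> g) x y = ev f x y \<oplus> ev g x y" if "f \<in> carrier F" "g \<in> carrier F" for f g x y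
    using eval_matrix_add[OF that] by (simp add: free_algebra_def)
  have zero: "ev \<zero>\<^bsub>F\<^esub> x y = \<zero>" for x y by (simp add: free_algebra_simps eval_matrix_zero)
  have inv: "ev (\<ominus>\<^bsub>F\<^esub> f) x y = \<zero>" if "f \<in> carrier F" "ev f x y = \<zero>" for f x y
    using add[of "\<ominus>\<^bsub>F\<^esub> f" f x y] that eval_matrix_closed[of "\<ominus>\<^bsub>F\<^esub> f"] by (simp add: F.l_neg zero)
  show ?thesis
  proof (rule idealI)
    show "ring F" by (rule free_algebra_ring)
    show "subgroup {f \<in> carrier F. \<forall>x\<in>V. \<forall>y\<in>V. ev f x y = \<zero>} (add_monoid F)"
      by (rule F.add.subgroupI) (auto simp: add zero inv intro: exI[of _ "\<zero>\<^bsub>F\<^esub>"])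
  qed (auto simp: eval_matrix_mult eval_matrix_closed intro!: add.finprod_one_eqI)
qed

end

section \<open>Leavitt path algebras of finite graphs\<close>

lemma free_word_eq_monom: "free_word K w = free_monom K \<one>\<^bsub>K\<^esub> w"
  by (simp add: free_word_def)

fun gen_source :: "('v, 'e) pre_digraph \<Rightarrow> ('v, 'e) lpa_gen \<Rightarrow> 'v" where
  "gen_source E (Vertex v) = v"
| "gen_source E (Edge e) = tail E e"
| "gen_source E (Ghost e) = head E e"

fun gen_target :: "('v, 'e) pre_digraph \<Rightarrow> ('v, 'e) lpa_gen \<Rightarrow> 'v" where
  "gen_target E (Vertex v) = v"
| "gen_target E (Edge e) = head E e"
| "gen_target E (Ghost e) = tail E e"

text \<open>The algebra \<open>L\<close> sits inside the unital ring \<open>Q = F / I\<close> as the image of the nonempty words, and has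
  the operations of \<open>Q\<close> but another identity, the sum of all vertices. The relations are therefore
  used first in \<open>Q\<close>, which is a ring by general theory, and this is how \<open>L\<close> is shown to be one.\<close>

locale finite_lpa = K: field K + fin_digraph E
  for K :: "('k, 'm) ring_scheme" and E :: "('v, 'e) pre_digraph"
begin

abbreviation "F \<equiv> lpa_free K E"
abbreviation "I \<equiv> lpa_ideal K E"
abbreviation "Q \<equiv> F Quot I"
abbreviation "L \<equiv> leavitt_path_algebra K E"
abbreviation "proj a \<equiv> I +>\<^bsub>F\<^esub> a"
abbreviation "wd w \<equiv> free_word K w"

definition "gen x = proj (wd [x])"
definition "F_plus = {a \<in> carrier F. a [] = \<zero>\<^bsub>K\<^esub>}"
definition "vertex_sum = (\<Oplus>\<^bsub>F\<^esub>v\<in>verts E. wd [Vertex v])"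

lemma finite_out_arcs: "finite (out_arcs E v)"
  by (rule finite_subset[OF _ finite_arcs]) (auto simp: out_arcs_def)

lemma gens [simp]:
  "v \<in> verts E \<Longrightarrow> Vertex v \<in> lpa_gens E" "e \<in> arcs E \<Longrightarrow> Edge e \<in> lpa_gens E"
  "e \<in> arcs E \<Longrightarrow> Ghost e \<in> lpa_gens E"
  by (auto simp: lpa_gens_def)

lemma lpa_gens_cases:
  assumes "x \<in> lpa_gens E"
  obtains (Vertex) v where "v \<in> verts E" "x = Vertex v"
  | (Edge) e where "e \<in> arcs E" "x = Edge e"
  | (Ghost) e where "e \<in> arcs E" "x = Ghost e"
  using assms by (auto simp: lpa_gens_def)

lemma gen_source_in_verts [simp]: "x \<in> lpa_gens E \<Longrightarrow> gen_source E x \<in> verts E"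
  and gen_target_in_verts [simp]: "x \<in> lpa_gens E \<Longrightarrow> gen_target E x \<in> verts E"
  by (auto simp: lpa_gens_def)

end

sublocale finite_lpa \<subseteq> F: ring "lpa_free K E"
  by (rule K.free_algebra_ring)

context finite_lpa begin

lemma word_closed: "w \<in> lists (lpa_gens E) \<Longrightarrow> wd w \<in> carrier F"
  unfolding free_word_eq_monom by (intro K.monom_in_free_algebra) auto

lemma gen_word_closed [simp]: "x \<in> lpa_gens E \<Longrightarrow> wd [x] \<in> carrier F"
  by (rule word_closed) simp

lemma relations_closed: "lpa_relations K E \<subseteq> carrier F"
  unfolding lpa_relations_def Let_def
  by (auto intro!: F.minus_closed F.m_closed F.finsum_closed simp: out_arcs_def regular_vertices_def)

lemma ideal_lpa: "ideal I F"
  unfolding lpa_ideal_def by (rule F.genideal_ideal[OF relations_closed])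

end

sublocale finite_lpa \<subseteq> I: ideal "lpa_ideal K E" "lpa_free K E"
  by (rule ideal_lpa)

sublocale finite_lpa \<subseteq> Q: ring "lpa_free K E Quot lpa_ideal K E"
  by (rule I.quotient_is_ring)

sublocale finite_lpa \<subseteq> q: ring_hom_ring "lpa_free K E" "lpa_free K E Quot lpa_ideal K E" "(+>\<^bsub>lpa_free K E\<^esub>) (lpa_ideal K E)"
  by (rule I.rcos_ring_hom_ring)

context finite_lpa begin

lemma proj_eqI:
  assumes "a \<in> carrier F" "b \<in> carrier F" "a \<ominus>\<^bsub>F\<^esub> b \<in> lpa_relations K E"
  shows "proj a = proj b"
proof -
  have "a \<ominus>\<^bsub>F\<^esub> b \<in> I"
    using assms(3) F.genideal_self[OF relations_closed] by (auto simp: lpa_ideal_def)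
  then show ?thesis using F.quotient_eq_iff_same_a_r_cos[OF ideal_lpa assms(1,2)] by simp
qed

lemma gen_in_Q [simp]: "x \<in> lpa_gens E \<Longrightarrow> gen x \<in> carrier Q"
  unfolding gen_def by (intro q.hom_closed) simp

lemma gen_mult_eqI:
  assumes "x \<in> lpa_gens E" "y \<in> lpa_gens E" "b \<in> carrier F"
    "wd [x] \<otimes>\<^bsub>F\<^esub> wd [y] \<ominus>\<^bsub>F\<^esub> b \<in> lpa_relations K E"
  shows "gen x \<otimes>\<^bsub>Q\<^esub> gen y = proj b"
proof -
  have "gen x \<otimes>\<^bsub>Q\<^esub> gen y = proj (wd [x] \<otimes>\<^bsub>F\<^esub> wd [y])"
    unfolding gen_def using assms by simp
  also have "\<dots> = proj b" by (rule proj_eqI) (use assms in auto)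
  finally show ?thesis .
qed

lemma vertex_mult_vertex:
  assumes "v \<in> verts E" "w \<in> verts E"
  shows "gen (Vertex v) \<otimes>\<^bsub>Q\<^esub> gen (Vertex w) = (if v = w then gen (Vertex w) else \<zero>\<^bsub>Q\<^esub>)"
proof -
  have "gen (Vertex v) \<otimes>\<^bsub>Q\<^esub> gen (Vertex w) = proj (if v = w then wd [Vertex w] else \<zero>\<^bsub>F\<^esub>)"
    by (rule gen_mult_eqI) (use assms in \<open>auto simp: lpa_relations_def Let_def\<close>)
  then show ?thesis by (simp add: gen_def)
qed

lemma edge_relations:
  assumes "e \<in> arcs E"
  shows "gen (Vertex (tail E e)) \<otimes>\<^bsub>Q\<^esub> gen (Edge e) = gen (Edge e)"
    and "gen (Edge e) \<otimes>\<^bsub>Q\<^esub> gen (Vertex (head E e)) = gen (Edge e)"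
    and "gen (Vertex (head E e)) \<otimes>\<^bsub>Q\<^esub> gen (Ghost e) = gen (Ghost e)"
    and "gen (Ghost e) \<otimes>\<^bsub>Q\<^esub> gen (Vertex (tail E e)) = gen (Ghost e)"
proof -
  have "gen (Vertex (tail E e)) \<otimes>\<^bsub>Q\<^esub> gen (Edge e) = proj (wd [Edge e])"
    "gen (Edge e) \<otimes>\<^bsub>Q\<^esub> gen (Vertex (head E e)) = proj (wd [Edge e])"
    "gen (Vertex (head E e)) \<otimes>\<^bsub>Q\<^esub> gen (Ghost e) = proj (wd [Ghost e])"
    "gen (Ghost e) \<otimes>\<^bsub>Q\<^esub> gen (Vertex (tail E e)) = proj (wd [Ghost e])"
    by (rule gen_mult_eqI; use assms in \<open>auto simp: lpa_relations_def Let_def\<close>)+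
  then show "gen (Vertex (tail E e)) \<otimes>\<^bsub>Q\<^esub> gen (Edge e) = gen (Edge e)"
    "gen (Edge e) \<otimes>\<^bsub>Q\<^esub> gen (Vertex (head E e)) = gen (Edge e)"
    "gen (Vertex (head E e)) \<otimes>\<^bsub>Q\<^esub> gen (Ghost e) = gen (Ghost e)"
    "gen (Ghost e) \<otimes>\<^bsub>Q\<^esub> gen (Vertex (tail E e)) = gen (Ghost e)"
    by (simp_all only: gen_def)
qed

lemma ghost_mult_edge:
  assumes "e \<in> arcs E" "f \<in> arcs E"
  shows "gen (Ghost e) \<otimes>\<^bsub>Q\<^esub> gen (Edge f) = (if e = f then gen (Vertex (head E e)) else \<zero>\<^bsub>Q\<^esub>)"
proof -
  have "gen (Ghost e) \<otimes>\<^bsub>Q\<^esub> gen (Edge f) = proj (if e = f then wd [Vertex (head E e)] else \<zero>\<^bsub>F\<^esub>)"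
    by (rule gen_mult_eqI) (use assms in \<open>auto simp: lpa_relations_def Let_def\<close>)
  then show ?thesis by (simp add: gen_def)
qed

lemma source_mult_gen: "x \<in> lpa_gens E \<Longrightarrow> gen (Vertex (gen_source E x)) \<otimes>\<^bsub>Q\<^esub> gen x = gen x"
  and gen_mult_target: "x \<in> lpa_gens E \<Longrightarrow> gen x \<otimes>\<^bsub>Q\<^esub> gen (Vertex (gen_target E x)) = gen x"
  by (erule lpa_gens_cases; simp add: edge_relations vertex_mult_vertex)+

text \<open>A vertex is a local left unit for the generators that start at it, and it annihilates the others
  because distinct vertices are orthogonal.\<close>

lemma vertex_mult_gen:
  assumes v: "v \<in> verts E" and x: "x \<in> lpa_gens E"
  shows "gen (Vertex v) \<otimes>\<^bsub>Q\<^esub> gen x = (if v = gen_source E x then gen x else \<zero>\<^bsub>Q\<^esub>)"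
proof -
  have "gen (Vertex v) \<otimes>\<^bsub>Q\<^esub> gen x = gen (Vertex v) \<otimes>\<^bsub>Q\<^esub> gen (Vertex (gen_source E x)) \<otimes>\<^bsub>Q\<^esub> gen x"
    using v x source_mult_gen[OF x] by (simp add: Q.m_assoc)
  then show ?thesis using v x source_mult_gen[OF x] by (simp add: vertex_mult_vertex)
qed

lemma gen_mult_vertex:
  assumes v: "v \<in> verts E" and x: "x \<in> lpa_gens E"
  shows "gen x \<otimes>\<^bsub>Q\<^esub> gen (Vertex v) = (if v = gen_target E x then gen x else \<zero>\<^bsub>Q\<^esub>)"
proof -
  have "gen x \<otimes>\<^bsub>Q\<^esub> gen (Vertex v) = gen x \<otimes>\<^bsub>Q\<^esub> (gen (Vertex (gen_target E x)) \<otimes>\<^bsub>Q\<^esub> gen (Vertex v))"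
    using v x gen_mult_target[OF x] by (simp flip: Q.m_assoc)
  then show ?thesis using v x gen_mult_target[OF x] by (simp add: vertex_mult_vertex)
qed

lemma vertex_sum_closed [simp]: "vertex_sum \<in> carrier F"
  unfolding vertex_sum_def by (intro F.finsum_closed) auto

lemma proj_vertex_sum: "proj vertex_sum = (\<Oplus>\<^bsub>Q\<^esub>v\<in>verts E. gen (Vertex v))"
  unfolding vertex_sum_def gen_def by (subst q.hom_finsum) (auto simp: comp_def)

lemma vertex_sum_mult_gen:
  assumes x: "x \<in> lpa_gens E"
  shows "proj vertex_sum \<otimes>\<^bsub>Q\<^esub> gen x = gen x"
proof -
  have "proj vertex_sum \<otimes>\<^bsub>Q\<^esub> gen x = (\<Oplus>\<^bsub>Q\<^esub>v\<in>verts E. gen (Vertex v) \<otimes>\<^bsub>Q\<^esub> gen x)"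
    unfolding proj_vertex_sum using x by (intro Q.finsum_ldistr) auto
  also have "\<dots> = (\<Oplus>\<^bsub>Q\<^esub>v\<in>verts E. if v = gen_source E x then gen x else \<zero>\<^bsub>Q\<^esub>)"
    using x by (intro Q.finsum_cong') (auto simp: vertex_mult_gen)
  also have "\<dots> = gen x" using x by (intro Q.finsum_delta) auto
  finally show ?thesis .
qed

lemma gen_mult_vertex_sum:
  assumes x: "x \<in> lpa_gens E"
  shows "gen x \<otimes>\<^bsub>Q\<^esub> proj vertex_sum = gen x"
proof -
  have "gen x \<otimes>\<^bsub>Q\<^esub> proj vertex_sum = (\<Oplus>\<^bsub>Q\<^esub>v\<in>verts E. gen x \<otimes>\<^bsub>Q\<^esub> gen (Vertex v))"
    unfolding proj_vertex_sum using x by (intro Q.finsum_rdistr) auto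
  also have "\<dots> = (\<Oplus>\<^bsub>Q\<^esub>v\<in>verts E. if v = gen_target E x then gen x else \<zero>\<^bsub>Q\<^esub>)"
    using x by (intro Q.finsum_cong') (auto simp: gen_mult_vertex)
  also have "\<dots> = gen x" using x by (intro Q.finsum_delta) auto
  finally show ?thesis .
qed

lemma monom_closed: "k \<in> carrier K \<Longrightarrow> w \<in> lists (lpa_gens E) \<Longrightarrow> free_monom K k w \<in> carrier F"
  by (rule K.monom_in_free_algebra)

text \<open>A nonempty word has a first and a last letter, on which the sum of all vertices acts as the identity
  from the left and from the right.\<close>

lemma vertex_sum_unit_monom:
  assumes k: "k \<in> carrier K" and w: "w \<in> lists (lpa_gens E)" "w \<noteq> []"
  shows "proj vertex_sum \<otimes>\<^bsub>Q\<^esub> proj (free_monom K k w) = proj (free_monom K k w)"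
    and "proj (free_monom K k w) \<otimes>\<^bsub>Q\<^esub> proj vertex_sum = proj (free_monom K k w)"
proof -
  obtain x u where xu: "w = [x] @ u" "x \<in> lpa_gens E" "u \<in> lists (lpa_gens E)"
    using w by (cases w) auto
  have "free_monom K k w = wd [x] \<otimes>\<^bsub>F\<^esub> free_monom K k u"
    unfolding free_word_eq_monom K.mult_free_algebra xu(1) using k
    by (subst K.conv_monom_monom) auto
  then have eq: "proj (free_monom K k w) = gen x \<otimes>\<^bsub>Q\<^esub> proj (free_monom K k u)"
    using xu k by (simp add: gen_def monom_closed)
  show "proj vertex_sum \<otimes>\<^bsub>Q\<^esub> proj (free_monom K k w) = proj (free_monom K k w)"
    unfolding eq using xu k vertex_sum_mult_gen[of x] by (simp add: monom_closed flip: Q.m_assoc)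
  obtain y v where yv: "w = v @ [y]" "y \<in> lpa_gens E" "v \<in> lists (lpa_gens E)"
    using w by (cases w rule: rev_cases) auto
  have "free_monom K k w = free_monom K k v \<otimes>\<^bsub>F\<^esub> wd [y]"
    unfolding free_word_eq_monom K.mult_free_algebra yv(1) using k
    by (subst K.conv_monom_monom) auto
  then have eq': "proj (free_monom K k w) = proj (free_monom K k v) \<otimes>\<^bsub>Q\<^esub> gen y"
    using yv k by (simp add: gen_def monom_closed)
  show "proj (free_monom K k w) \<otimes>\<^bsub>Q\<^esub> proj vertex_sum = proj (free_monom K k w)"
    unfolding eq' using yv k gen_mult_vertex_sum[of y] by (simp add: monom_closed Q.m_assoc)
qed

lemma vertex_sum_unit:
  assumes "a \<in> F_plus"
  shows "proj vertex_sum \<otimes>\<^bsub>Q\<^esub> proj a = proj a \<and> proj a \<otimes>\<^bsub>Q\<^esub> proj vertex_sum = proj a"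
proof -
  have "a \<in> carrier F" and a0: "a [] = \<zero>\<^bsub>K\<^esub>" using assms by (auto simp: F_plus_def)
  from this(1) show ?thesis
  proof (induction a rule: K.free_algebra_induct)
    case zero
    have "proj (\<lambda>w. \<zero>\<^bsub>K\<^esub>) = \<zero>\<^bsub>Q\<^esub>" using q.hom_zero by (simp add: free_algebra_simps)
    then show ?case using q.hom_closed[OF vertex_sum_closed] by simp
  next
    case (add k w g)
    then have "w \<noteq> []" using a0 by auto
    note m = vertex_sum_unit_monom[OF add.hyps(1,2) this]
    have mc: "free_monom K k w \<in> carrier F" using add by (intro monom_closed)
    have "proj (\<lambda>u. free_monom K k w u \<oplus>\<^bsub>K\<^esub> g u) = proj (free_monom K k w) \<oplus>\<^bsub>Q\<^esub> proj g"
      using q.hom_add[OF mc add.hyps(4)] by (simp only: K.add_free_algebra)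
    then show ?case
      using m add.IH q.hom_closed[OF mc] q.hom_closed[OF add.hyps(4)] q.hom_closed[OF vertex_sum_closed]
      by (simp add: Q.l_distr Q.r_distr)
  qed
qed

lemma lpa_simps:
  "carrier L = proj ` F_plus" "mult L = mult Q" "add L = add Q" "\<zero>\<^bsub>L\<^esub> = \<zero>\<^bsub>Q\<^esub>"
  "\<one>\<^bsub>L\<^esub> = proj vertex_sum"
proof -
  show "carrier L = proj ` F_plus"
    unfolding leavitt_path_algebra_def Let_def F_plus_def image_def by (simp, blast)
qed (simp_all only: leavitt_path_algebra_def Let_def FactRing_def vertex_sum_def
    partial_object.simps monoid.simps ring.simps)

lemma F_plus_in_F: "a \<in> F_plus \<Longrightarrow> a \<in> carrier F"
  by (simp add: F_plus_def)

lemma gen_word_in_F_plus: "x \<in> lpa_gens E \<Longrightarrow> wd [x] \<in> F_plus"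
  using gen_word_closed[of x] unfolding F_plus_def by (simp add: free_word_def)

lemma F_plus_add: "a \<in> F_plus \<Longrightarrow> b \<in> F_plus \<Longrightarrow> a \<oplus>\<^bsub>F\<^esub> b \<in> F_plus"
  by (simp add: F_plus_def free_algebra_simps)

lemma F_plus_mult: "a \<in> F_plus \<Longrightarrow> b \<in> F_plus \<Longrightarrow> a \<otimes>\<^bsub>F\<^esub> b \<in> F_plus"
proof -
  assume "a \<in> F_plus" "b \<in> F_plus"
  moreover from this have "(a \<otimes>\<^bsub>F\<^esub> b) [] = \<zero>\<^bsub>K\<^esub>"
    by (simp add: K.mult_free_algebra K.conv_Nil F_plus_def)
  ultimately show ?thesis by (simp add: F_plus_def)
qed

lemma F_plus_zero: "\<zero>\<^bsub>F\<^esub> \<in> F_plus"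
proof -
  have "\<zero>\<^bsub>F\<^esub> [] = \<zero>\<^bsub>K\<^esub>" by (simp only: free_algebra_simps)
  then show ?thesis by (simp add: F_plus_def)
qed

lemma F_plus_neg: "a \<in> F_plus \<Longrightarrow> \<ominus>\<^bsub>F\<^esub> a \<in> F_plus"
proof -
  assume a: "a \<in> F_plus"
  have "(\<ominus>\<^bsub>F\<^esub> a \<oplus>\<^bsub>F\<^esub> a) [] = \<zero>\<^bsub>K\<^esub>"
    using F_plus_in_F[OF a] by (simp only: F.l_neg free_algebra_simps)
  then have "(\<ominus>\<^bsub>F\<^esub> a) [] = \<zero>\<^bsub>K\<^esub>"
    using a free_algebra_carrierD(1)[OF F.a_inv_closed[OF F_plus_in_F[OF a]], of "[]"]
    by (simp add: free_algebra_simps(3) F_plus_def)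
  then show "\<ominus>\<^bsub>F\<^esub> a \<in> F_plus" using F_plus_in_F[OF a] by (simp add: F_plus_def)
qed

lemma F_plus_finsum:
  "finite A \<Longrightarrow> (\<And>i. i \<in> A \<Longrightarrow> f i \<in> F_plus) \<Longrightarrow> (\<Oplus>\<^bsub>F\<^esub>i\<in>A. f i) \<in> F_plus"
proof (induction A rule: finite_induct)
  case (insert i A)
  then show ?case using F_plus_in_F by (simp add: F_plus_add Pi_def)
qed (simp add: F_plus_zero)

lemma vertex_sum_in_F_plus: "vertex_sum \<in> F_plus"
  unfolding vertex_sum_def by (intro F_plus_finsum) (auto simp: gen_word_in_F_plus)

lemma in_L_E:
  assumes "X \<in> carrier L"
  obtains a where "a \<in> F_plus" "X = proj a"
  using assms unfolding lpa_simps(1) by blast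

lemma proj_in_L: "a \<in> F_plus \<Longrightarrow> proj a \<in> carrier L"
  unfolding lpa_simps(1) by (rule imageI)

lemma L_in_Q: "X \<in> carrier L \<Longrightarrow> X \<in> carrier Q"
  by (elim in_L_E) (simp add: F_plus_in_F)

lemma L_add_closed:
  assumes "X \<in> carrier L" "Y \<in> carrier L"
  shows "X \<oplus>\<^bsub>Q\<^esub> Y \<in> carrier L"
proof -
  obtain a b where ab: "a \<in> F_plus" "X = proj a" "b \<in> F_plus" "Y = proj b"
    using assms by (elim in_L_E)
  then have "X \<oplus>\<^bsub>Q\<^esub> Y = proj (a \<oplus>\<^bsub>F\<^esub> b)" by (simp add: F_plus_in_F)
  then show ?thesis using ab by (simp only: F_plus_add proj_in_L)
qed

lemma L_mult_closed:
  assumes "X \<in> carrier L" "Y \<in> carrier L"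
  shows "X \<otimes>\<^bsub>Q\<^esub> Y \<in> carrier L"
proof -
  obtain a b where ab: "a \<in> F_plus" "X = proj a" "b \<in> F_plus" "Y = proj b"
    using assms by (elim in_L_E)
  then have "X \<otimes>\<^bsub>Q\<^esub> Y = proj (a \<otimes>\<^bsub>F\<^esub> b)" by (simp add: F_plus_in_F)
  then show ?thesis using ab by (simp only: F_plus_mult proj_in_L)
qed

lemma lpa_ring: "ring L"
proof (rule ringI)
  show "abelian_group L"
  proof (rule abelian_groupI)
    show "\<zero>\<^bsub>L\<^esub> \<in> carrier L"
      using proj_in_L[OF F_plus_zero] by (simp only: q.hom_zero lpa_simps(4))
    show "\<exists>Y\<in>carrier L. Y \<oplus>\<^bsub>L\<^esub> X = \<zero>\<^bsub>L\<^esub>" if X: "X \<in> carrier L" for X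
    proof -
      obtain a where a: "a \<in> F_plus" "X = proj a" using X by (elim in_L_E)
      note aF = F_plus_in_F[OF a(1)]
      have "proj (\<ominus>\<^bsub>F\<^esub> a) \<oplus>\<^bsub>Q\<^esub> X = proj (\<ominus>\<^bsub>F\<^esub> a \<oplus>\<^bsub>F\<^esub> a)"
        unfolding a(2) using q.hom_add[OF F.a_inv_closed[OF aF] aF] by (rule sym)
      also have "\<dots> = \<zero>\<^bsub>Q\<^esub>" by (simp only: F.l_neg[OF aF] q.hom_zero)
      finally show ?thesis
        using proj_in_L[OF F_plus_neg[OF a(1)]] by (intro bexI) (simp_all only: lpa_simps(3,4))
    qed
  qed (simp_all add: lpa_simps(2-4) L_add_closed L_in_Q Q.a_ac)
  show "monoid L"
  proof (rule monoidI)
    show "\<one>\<^bsub>L\<^esub> \<in> carrier L"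
      unfolding lpa_simps(5) by (rule proj_in_L[OF vertex_sum_in_F_plus])
    show "\<one>\<^bsub>L\<^esub> \<otimes>\<^bsub>L\<^esub> X = X" "X \<otimes>\<^bsub>L\<^esub> \<one>\<^bsub>L\<^esub> = X" if "X \<in> carrier L" for X
      using that vertex_sum_unit unfolding lpa_simps(2,5) by (auto elim!: in_L_E)
  qed (simp_all add: lpa_simps(2-4) L_mult_closed L_in_Q Q.m_assoc)
qed (simp_all add: lpa_simps(2-4) L_in_Q Q.l_distr Q.r_distr)

end

sublocale finite_lpa \<subseteq> L: ring "leavitt_path_algebra K E"
  by (rule lpa_ring)

context finite_lpa begin

lemma gen_in_L [simp]: "x \<in> lpa_gens E \<Longrightarrow> gen x \<in> carrier L"
  unfolding gen_def by (intro proj_in_L gen_word_in_F_plus)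

lemma finsum_L_eq_Q:
  "finite A \<Longrightarrow> (\<And>i. i \<in> A \<Longrightarrow> f i \<in> carrier L) \<Longrightarrow> (\<Oplus>\<^bsub>L\<^esub>i\<in>A. f i) = (\<Oplus>\<^bsub>Q\<^esub>i\<in>A. f i)"
proof (induction A rule: finite_induct)
  case empty
  then show ?case by (simp add: lpa_simps)
next
  case (insert i A)
  then show ?case using L_in_Q by (simp add: Pi_def lpa_simps(3))
qed

lemma vertices_sum_one: "(\<Oplus>\<^bsub>L\<^esub>v\<in>verts E. gen (Vertex v)) = \<one>\<^bsub>L\<^esub>"
  by (simp add: finsum_L_eq_Q proj_vertex_sum lpa_simps(5))

text \<open>In a finite graph a vertex is regular as soon as it emits an edge.\<close>

lemma regular_vertex_sum:
  assumes v: "v \<in> verts E" and ne: "out_arcs E v \<noteq> {}"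
  shows "(\<Oplus>\<^bsub>L\<^esub>e\<in>out_arcs E v. gen (Edge e) \<otimes>\<^bsub>L\<^esub> gen (Ghost e)) = gen (Vertex v)"
proof -
  have arc: "e \<in> arcs E" if "e \<in> out_arcs E v" for e using that by (simp add: out_arcs_def)
  let ?s = "\<Oplus>\<^bsub>F\<^esub>e\<in>out_arcs E v. wd [Edge e] \<otimes>\<^bsub>F\<^esub> wd [Ghost e]"
  have s: "?s \<in> carrier F" by (intro F.finsum_closed) (auto simp: arc)
  have "v \<in> regular_vertices E" using v ne finite_out_arcs by (simp add: regular_vertices_def)
  then have "wd [Vertex v] \<ominus>\<^bsub>F\<^esub> ?s \<in> lpa_relations K E"
    by (auto simp: lpa_relations_def Let_def)
  then have "gen (Vertex v) = proj ?s"
    unfolding gen_def by (intro proj_eqI) (use v s in auto)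
  also have "\<dots> = (\<Oplus>\<^bsub>Q\<^esub>e\<in>out_arcs E v. gen (Edge e) \<otimes>\<^bsub>Q\<^esub> gen (Ghost e))"
  proof (subst q.hom_finsum)
    show "(\<Oplus>\<^bsub>Q\<^esub>e\<in>out_arcs E v. ((+>\<^bsub>F\<^esub>) I \<circ> (\<lambda>e. wd [Edge e] \<otimes>\<^bsub>F\<^esub> wd [Ghost e])) e) =
        (\<Oplus>\<^bsub>Q\<^esub>e\<in>out_arcs E v. gen (Edge e) \<otimes>\<^bsub>Q\<^esub> gen (Ghost e))"
      by (rule Q.finsum_cong') (simp_all add: arc gen_def)
  qed (simp add: arc)
  also have "\<dots> = (\<Oplus>\<^bsub>L\<^esub>e\<in>out_arcs E v. gen (Edge e) \<otimes>\<^bsub>L\<^esub> gen (Ghost e))"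
    by (subst finsum_L_eq_Q) (auto simp: finite_out_arcs arc lpa_simps(2) L_mult_closed)
  finally show ?thesis by simp
qed

section \<open>The grading\<close>

definition homogeneous where
  "homogeneous n = {a \<in> carrier F. \<forall>w. a w \<noteq> \<zero>\<^bsub>K\<^esub> \<longrightarrow> w \<noteq> [] \<and> sum_list (map gen_degree w) = n}"

lemma lpa_grading_eq: "lpa_grading K E n = proj ` homogeneous n"
  by (auto simp: lpa_grading_def Let_def homogeneous_def)

lemma homogeneous_in_F_plus: "a \<in> homogeneous n \<Longrightarrow> a \<in> F_plus"
  by (auto simp: homogeneous_def F_plus_def)

lemma lpa_grading_mult:
  assumes "X \<in> lpa_grading K E m" "Y \<in> lpa_grading K E n"
  shows "X \<otimes>\<^bsub>L\<^esub> Y \<in> lpa_grading K E (m + n)"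
proof -
  obtain a b where ab: "a \<in> homogeneous m" "b \<in> homogeneous n" "X = proj a" "Y = proj b"
    using assms by (auto simp: lpa_grading_eq)
  have F: "a \<in> carrier F" "b \<in> carrier F" using ab by (auto simp: homogeneous_def)
  have "a \<otimes>\<^bsub>F\<^esub> b \<in> homogeneous (m + n)"
    unfolding homogeneous_def
  proof (intro CollectI conjI allI impI)
    fix w assume "(a \<otimes>\<^bsub>F\<^esub> b) w \<noteq> \<zero>\<^bsub>K\<^esub>"
    then have "K.conv a b w \<noteq> \<zero>\<^bsub>K\<^esub>" by (simp add: K.mult_free_algebra)
    then obtain u v where "w = u @ v" "a u \<noteq> \<zero>\<^bsub>K\<^esub>" "b v \<noteq> \<zero>\<^bsub>K\<^esub>"
      using K.conv_nonzeroD free_algebra_carrierD(1)[OF F(1)] free_algebra_carrierD(1)[OF F(2)] by metis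
    then show "w \<noteq> []" "sum_list (map gen_degree w) = m + n"
      using ab by (auto simp: homogeneous_def)
  qed (use F in auto)
  moreover have "X \<otimes>\<^bsub>L\<^esub> Y = proj (a \<otimes>\<^bsub>F\<^esub> b)" using F ab by (simp add: lpa_simps(2))
  ultimately show ?thesis by (simp add: lpa_grading_eq)
qed

lemma lpa_grading_add:
  assumes "X \<in> lpa_grading K E n" "Y \<in> lpa_grading K E n"
  shows "X \<oplus>\<^bsub>L\<^esub> Y \<in> lpa_grading K E n"
proof -
  obtain a b where ab: "a \<in> homogeneous n" "b \<in> homogeneous n" "X = proj a" "Y = proj b"
    using assms by (auto simp: lpa_grading_eq)
  have F: "a \<in> carrier F" "b \<in> carrier F" using ab by (auto simp: homogeneous_def)
  have "a \<oplus>\<^bsub>F\<^esub> b \<in> homogeneous n"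
    unfolding homogeneous_def
  proof (intro CollectI conjI allI impI)
    fix w assume "(a \<oplus>\<^bsub>F\<^esub> b) w \<noteq> \<zero>\<^bsub>K\<^esub>"
    then have "a w \<noteq> \<zero>\<^bsub>K\<^esub> \<or> b w \<noteq> \<zero>\<^bsub>K\<^esub>" by (auto simp: free_algebra_simps)
    then show "w \<noteq> []" "sum_list (map gen_degree w) = n" using ab by (auto simp: homogeneous_def)
  qed (use F in auto)
  moreover have "X \<oplus>\<^bsub>L\<^esub> Y = proj (a \<oplus>\<^bsub>F\<^esub> b)" using F ab by (simp add: lpa_simps(3))
  ultimately show ?thesis by (simp add: lpa_grading_eq)
qed

lemma lpa_grading_zero: "\<zero>\<^bsub>L\<^esub> \<in> lpa_grading K E n"
proof -
  have "\<zero>\<^bsub>F\<^esub> \<in> homogeneous n" by (simp add: homogeneous_def) (simp add: free_algebra_simps)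
  then have "proj \<zero>\<^bsub>F\<^esub> \<in> lpa_grading K E n" unfolding lpa_grading_eq by (rule imageI)
  then show ?thesis unfolding lpa_simps(4) by (simp only: q.hom_zero)
qed

lemma lpa_grading_finsum:
  assumes "finite A" "\<And>i. i \<in> A \<Longrightarrow> f i \<in> lpa_grading K E n"
  shows "(\<Oplus>\<^bsub>L\<^esub>i\<in>A. f i) \<in> lpa_grading K E n"
  using assms
proof (induction A rule: finite_induct)
  case empty
  then show ?case by (simp add: lpa_grading_zero)
next
  case (insert i A)
  have "lpa_grading K E n \<subseteq> carrier L"
    using homogeneous_in_F_plus by (auto simp: lpa_grading_eq lpa_simps)
  then have "f j \<in> carrier L" if "j \<in> insert i A" for j using insert.prems that by blast
  then show ?case using insert by (simp add: lpa_grading_add Pi_def)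
qed

lemma gen_in_lpa_grading:
  assumes "x \<in> lpa_gens E"
  shows "gen x \<in> lpa_grading K E (gen_degree x)"
  using gen_word_closed[OF assms] unfolding lpa_grading_eq gen_def
  by (intro imageI) (auto simp: homogeneous_def free_word_def split: if_splits)

lemma ghost_mult_edge_L:
  assumes "e \<in> arcs E" "f \<in> arcs E"
  shows "gen (Ghost e) \<otimes>\<^bsub>L\<^esub> gen (Edge f) = (if e = f then gen (Vertex (head E e)) else \<zero>\<^bsub>L\<^esub>)"
  unfolding lpa_simps(2,4) by (rule ghost_mult_edge[OF assms])

text \<open>The vertices at the two heads, which fit between the factors, are orthogonal.\<close>

lemma edge_mult_ghost_zero:
  assumes e: "e \<in> arcs E" and f: "f \<in> arcs E" and ne: "head E e \<noteq> head E f"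
  shows "gen (Edge e) \<otimes>\<^bsub>L\<^esub> gen (Ghost f) = \<zero>\<^bsub>L\<^esub>"
proof -
  have "gen (Edge e) \<otimes>\<^bsub>Q\<^esub> gen (Ghost f) =
      gen (Edge e) \<otimes>\<^bsub>Q\<^esub> (gen (Vertex (head E e)) \<otimes>\<^bsub>Q\<^esub> gen (Ghost f))"
    using e f edge_relations(2)[OF e] by (simp flip: Q.m_assoc)
  then show ?thesis
    unfolding lpa_simps(2,4) using e f ne by (simp add: vertex_mult_gen)
qed

end

context finite_lpa begin

section \<open>Out-degree at most one: a matrix representation\<close>

text \<open>Vertices act as diagonal matrix units, an edge from \<open>x\<close> to \<open>y\<close> as the matrix unit \<open>E_xy\<close>, and its ghost
  as the transpose \<open>E_yx\<close>.\<close>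

definition gen_matrix :: "('v, 'e) lpa_gen \<Rightarrow> 'v \<Rightarrow> 'v \<Rightarrow> 'k" where
  "gen_matrix g x y = (if x = gen_source E g \<and> y = gen_target E g then \<one>\<^bsub>K\<^esub> else \<zero>\<^bsub>K\<^esub>)"

end

sublocale finite_lpa \<subseteq> M: matrix_family K "lpa_gens E" "verts E" gen_matrix
  by unfold_locales (auto simp: gen_matrix_def)

context finite_lpa begin

lemma eval_gen:
  assumes "g \<in> lpa_gens E" "y \<in> verts E"
  shows "M.ev (wd [g]) x y = gen_matrix g x y"
proof -
  have "M.W [g] x y = (\<Oplus>\<^bsub>K\<^esub>z\<in>verts E. if z = y then gen_matrix g x z else \<zero>\<^bsub>K\<^esub>)"
    using assms by (auto simp: M.M_closed intro!: K.finsum_cong')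
  also have "\<dots> = gen_matrix g x y" using assms by (intro K.finsum_delta) (auto simp: M.M_closed)
  finally show ?thesis
    using assms M.M_closed unfolding free_word_eq_monom by (subst M.eval_matrix_monom) auto
qed

lemma eval_gen_mult:
  assumes g: "g \<in> lpa_gens E" and h: "h \<in> lpa_gens E" and xy: "x \<in> verts E" "y \<in> verts E"
  shows "M.ev (wd [g] \<otimes>\<^bsub>F\<^esub> wd [h]) x y =
    (if x = gen_source E g \<and> gen_target E g = gen_source E h \<and> y = gen_target E h then \<one>\<^bsub>K\<^esub> else \<zero>\<^bsub>K\<^esub>)"
proof -
  have "M.ev (wd [g] \<otimes>\<^bsub>F\<^esub> wd [h]) x y =
      (\<Oplus>\<^bsub>K\<^esub>z\<in>verts E. M.ev (wd [g]) x z \<otimes>\<^bsub>K\<^esub> M.ev (wd [h]) z y)"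
    by (rule M.eval_matrix_mult) (use assms in auto)
  also have "\<dots> = (\<Oplus>\<^bsub>K\<^esub>z\<in>verts E. if z = gen_target E g then gen_matrix g x z \<otimes>\<^bsub>K\<^esub> gen_matrix h z y else \<zero>\<^bsub>K\<^esub>)"
    using assms by (intro K.finsum_cong') (auto simp: eval_gen gen_matrix_def)
  also have "\<dots> = gen_matrix g x (gen_target E g) \<otimes>\<^bsub>K\<^esub> gen_matrix h (gen_target E g) y"
    using assms by (intro K.finsum_delta) (auto simp: gen_matrix_def)
  finally show ?thesis by (auto simp: gen_matrix_def)
qed

definition "rep_kernel = {f \<in> carrier F. \<forall>x\<in>verts E. \<forall>y\<in>verts E. M.ev f x y = \<zero>\<^bsub>K\<^esub>}"

lemma eval_add: "a \<in> carrier F \<Longrightarrow> b \<in> carrier F \<Longrightarrow> M.ev (a \<oplus>\<^bsub>F\<^esub> b) x y = M.ev a x y \<oplus>\<^bsub>K\<^esub> M.ev b x y"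
  using M.eval_matrix_add by (simp add: K.add_free_algebra)

lemma eval_zero: "M.ev \<zero>\<^bsub>F\<^esub> x y = \<zero>\<^bsub>K\<^esub>"
  using M.eval_matrix_zero by (simp only: free_algebra_simps)

lemma diff_in_rep_kernel_iff:
  assumes a: "a \<in> carrier F" and b: "b \<in> carrier F"
  shows "a \<ominus>\<^bsub>F\<^esub> b \<in> rep_kernel \<longleftrightarrow> (\<forall>x\<in>verts E. \<forall>y\<in>verts E. M.ev a x y = M.ev b x y)"
proof -
  have ab: "a \<ominus>\<^bsub>F\<^esub> b \<in> carrier F" using a b by simp
  have "a = (a \<ominus>\<^bsub>F\<^esub> b) \<oplus>\<^bsub>F\<^esub> b" using a b by (simp add: F.minus_eq F.a_assoc F.l_neg)
  then have "M.ev a x y = M.ev (a \<ominus>\<^bsub>F\<^esub> b) x y \<oplus>\<^bsub>K\<^esub> M.ev b x y" for x y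
    using eval_add[OF ab b] by simp
  then have "M.ev (a \<ominus>\<^bsub>F\<^esub> b) x y = \<zero>\<^bsub>K\<^esub> \<longleftrightarrow> M.ev a x y = M.ev b x y" for x y
    using M.eval_matrix_closed[OF ab] M.eval_matrix_closed[OF b]
    by (metis K.add.l_cancel_one K.add.m_comm)
  then show ?thesis using ab by (simp add: rep_kernel_def)
qed

text \<open>This is where the bound on the out-degree enters. With distinct edges \<open>e\<close> and \<open>f\<close> of the same source,
  the matrix of \<open>e* f\<close> would be a nonzero matrix unit instead of zero, and \<open>\<Sum> e e*\<close> would count the
  diagonal matrix unit of the source once for every edge.\<close>

lemma relations_in_rep_kernel:
  assumes deg: "inj_on (tail E) (arcs E)"
  shows "lpa_relations K E \<subseteq> rep_kernel"
proof -
  have regular: "v \<in> verts E"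
      "(\<Oplus>\<^bsub>F\<^esub>e\<in>out_arcs E v. wd [Edge e] \<otimes>\<^bsub>F\<^esub> wd [Ghost e]) \<in> carrier F"
      "x \<in> verts E \<Longrightarrow> y \<in> verts E \<Longrightarrow>
        M.ev (\<Oplus>\<^bsub>F\<^esub>e\<in>out_arcs E v. wd [Edge e] \<otimes>\<^bsub>F\<^esub> wd [Ghost e]) x y =
        (if x = v \<and> y = v then \<one>\<^bsub>K\<^esub> else \<zero>\<^bsub>K\<^esub>)"
    if v: "v \<in> regular_vertices E" for v x y
  proof -
    obtain e where e: "e \<in> out_arcs E v" using v unfolding regular_vertices_def by blast
    then have arc: "e \<in> arcs E" "tail E e = v" by (auto simp: out_arcs_def)
    have "out_arcs E v = {e}" using e deg by (auto simp: out_arcs_def inj_on_def)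
    then have sum: "(\<Oplus>\<^bsub>F\<^esub>e\<in>out_arcs E v. wd [Edge e] \<otimes>\<^bsub>F\<^esub> wd [Ghost e]) = wd [Edge e] \<otimes>\<^bsub>F\<^esub> wd [Ghost e]"
      using arc by simp
    show "v \<in> verts E" using v by (simp add: regular_vertices_def)
    show "(\<Oplus>\<^bsub>F\<^esub>e\<in>out_arcs E v. wd [Edge e] \<otimes>\<^bsub>F\<^esub> wd [Ghost e]) \<in> carrier F"
      unfolding sum using arc by simp
    show "x \<in> verts E \<Longrightarrow> y \<in> verts E \<Longrightarrow>
        M.ev (\<Oplus>\<^bsub>F\<^esub>e\<in>out_arcs E v. wd [Edge e] \<otimes>\<^bsub>F\<^esub> wd [Ghost e]) x y =
        (if x = v \<and> y = v then \<one>\<^bsub>K\<^esub> else \<zero>\<^bsub>K\<^esub>)"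
      unfolding sum using arc by (simp add: eval_gen_mult)
  qed
  have inj: "tail E e = tail E f \<longleftrightarrow> e = f" if "e \<in> arcs E" "f \<in> arcs E" for e f
    using deg that by (auto simp: inj_on_def)
  show ?thesis
    unfolding lpa_relations_def Let_def
  proof (intro Un_least subsetI; elim CollectE exE conjE; hypsubst; subst diff_in_rep_kernel_iff)
  qed (simp_all add: eval_gen eval_gen_mult gen_matrix_def eval_zero inj regular)
qed

text \<open>Evaluation at the matrices vanishes on the ideal of relations, so it descends to a representation of
  \<open>L\<close>. It is unital because the diagonal matrix units add up to the identity matrix.\<close>

theorem IBN_if_out_degree_le_1:
  assumes deg: "inj_on (tail E) (arcs E)" and ne: "verts E \<noteq> {}"
  shows "IBN L"
proof -
  have I: "I \<subseteq> rep_kernel"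
    unfolding lpa_ideal_def
    using F.genideal_minimal[OF _ relations_in_rep_kernel[OF deg]] M.eval_matrix_kernel_ideal
    by (simp add: rep_kernel_def)
  have eval_cong: "M.ev a x y = M.ev b x y"
    if "proj a = proj b" "a \<in> carrier F" "b \<in> carrier F" "x \<in> verts E" "y \<in> verts E" for a b x y
    using that I diff_in_rep_kernel_iff[of a b] F.quotient_eq_iff_same_a_r_cos[OF ideal_lpa, of a b]
    by blast
  \<comment> \<open>the choice of a representative is immaterial by \<open>eval_cong\<close>\<close>
  define \<rho> where "\<rho> X = M.ev (SOME a. a \<in> F_plus \<and> X = proj a)" for X
  have \<rho>: "\<rho> (proj a) x y = M.ev a x y" if a: "a \<in> F_plus" and "x \<in> verts E" "y \<in> verts E" for a x y
  proof -
    have "\<exists>b. b \<in> F_plus \<and> proj a = proj b" using a by blast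
    from someI_ex[OF this] show ?thesis
      unfolding \<rho>_def using that by (intro eval_cong) (auto simp: F_plus_in_F)
  qed
  interpret R: matrix_representation L K "verts E" \<rho>
  proof unfold_locales
    fix x y assume xy: "x \<in> verts E" "y \<in> verts E"
    show "\<rho> X x y \<in> carrier K" if "X \<in> carrier L" for X
      using that xy by (elim in_L_E) (simp add: \<rho> F_plus_in_F M.eval_matrix_closed)
    have "\<rho> \<one>\<^bsub>L\<^esub> x y = M.ev vertex_sum x y"
      unfolding lpa_simps(5) by (rule \<rho>[OF vertex_sum_in_F_plus xy])
    also have "\<dots> = (\<Oplus>\<^bsub>K\<^esub>v\<in>verts E. M.ev (wd [Vertex v]) x y)"
      unfolding vertex_sum_def by (rule M.eval_matrix_finsum) auto
    also have "\<dots> = (\<Oplus>\<^bsub>K\<^esub>v\<in>verts E. if v = x then gen_matrix (Vertex v) x y else \<zero>\<^bsub>K\<^esub>)"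
      using xy by (intro K.finsum_cong') (auto simp: eval_gen gen_matrix_def)
    also have "\<dots> = gen_matrix (Vertex x) x y"
      using xy by (intro K.finsum_delta) (auto simp: gen_matrix_def)
    finally show "\<rho> \<one>\<^bsub>L\<^esub> x y = (if x = y then \<one>\<^bsub>K\<^esub> else \<zero>\<^bsub>K\<^esub>)" by (simp add: gen_matrix_def)
    fix X Y assume "X \<in> carrier L" "Y \<in> carrier L"
    then obtain a b where ab: "a \<in> F_plus" "X = proj a" "b \<in> F_plus" "Y = proj b" by (elim in_L_E)
    have sum: "X \<oplus>\<^bsub>L\<^esub> Y = proj (a \<oplus>\<^bsub>F\<^esub> b)" and prod: "X \<otimes>\<^bsub>L\<^esub> Y = proj (a \<otimes>\<^bsub>F\<^esub> b)"
      using ab by (simp_all add: lpa_simps(2,3) F_plus_in_F)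
    have "\<rho> (X \<oplus>\<^bsub>L\<^esub> Y) x y = M.ev (a \<oplus>\<^bsub>F\<^esub> b) x y"
      unfolding sum by (rule \<rho>[OF F_plus_add xy]) (rule ab)+
    then show "\<rho> (X \<oplus>\<^bsub>L\<^esub> Y) x y = \<rho> X x y \<oplus>\<^bsub>K\<^esub> \<rho> Y x y"
      using ab xy by (simp add: \<rho> F_plus_in_F eval_add)
    have "\<rho> (X \<otimes>\<^bsub>L\<^esub> Y) x y = M.ev (a \<otimes>\<^bsub>F\<^esub> b) x y"
      unfolding prod by (rule \<rho>[OF F_plus_mult xy]) (rule ab)+
    also have "\<dots> = (\<Oplus>\<^bsub>K\<^esub>z\<in>verts E. M.ev a x z \<otimes>\<^bsub>K\<^esub> M.ev b z y)"
      using ab xy by (intro M.eval_matrix_mult F_plus_in_F)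
    also have "\<dots> = (\<Oplus>\<^bsub>K\<^esub>z\<in>verts E. \<rho> X x z \<otimes>\<^bsub>K\<^esub> \<rho> Y z y)"
      using ab xy by (intro K.finsum_cong') (auto simp: \<rho> F_plus_in_F M.eval_matrix_closed)
    finally show "\<rho> (X \<otimes>\<^bsub>L\<^esub> Y) x y = (\<Oplus>\<^bsub>K\<^esub>z\<in>verts E. \<rho> X x z \<otimes>\<^bsub>K\<^esub> \<rho> Y z y)" .
  qed (use ne in auto)
  show ?thesis by (rule R.IBN)
qed

end

section \<open>Edges labelled by permutations: Leavitt relations\<close>

text \<open>Here each label \<open>l\<close> in \<open>S\<close> marks one edge out of every vertex, and also one edge into every vertex. Let
  \<open>a l\<close> be the sum of the edges labelled \<open>l\<close> and \<open>b l\<close> the sum of their ghosts. In \<open>b l a m\<close> only the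
  products \<open>e* e\<close> survive, so it vanishes unless \<open>l = m\<close>; and \<open>b l a l\<close> is the sum of the heads of the
  edges labelled \<open>l\<close>, that is, the sum of all vertices. In \<open>a l b l\<close> the mixed products of edges and
  ghosts vanish since the heads differ, so that summing over \<open>l\<close> gives the sum of \<open>e e*\<close> over
  all edges, again the sum of all vertices. These are the Leavitt relations.\<close>

theorem not_gr_IBN_if_permutation_labelled:
  fixes K :: "('k, 'm) ring_scheme" and E :: "('v, 'v \<times> 'l) pre_digraph"
  assumes "field K" and "fin_digraph E"
    and arcs: "arcs E = verts E \<times> S" and tail: "tail E = fst" and S: "finite S" "2 \<le> card S"
    and perm: "\<And>l. l \<in> S \<Longrightarrow> bij_betw (\<lambda>x. head E (x, l)) (verts E) (verts E)"
  shows "\<not> gr_IBN (leavitt_path_algebra K E) (lpa_grading K E)"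
proof -
  interpret finite_lpa K E using assms(1,2) by (rule finite_lpa.intro)
  let ?V = "verts E"
  define a where "a l = (\<Oplus>\<^bsub>L\<^esub>x\<in>?V. gen (Edge (x, l)))" for l
  define b where "b l = (\<Oplus>\<^bsub>L\<^esub>x\<in>?V. gen (Ghost (x, l)))" for l
  have g: "gen (Edge (x, l)) \<in> carrier L" "gen (Ghost (x, l)) \<in> carrier L" "gen (Vertex x) \<in> carrier L"
    "gen (Vertex (head E (x, l))) \<in> carrier L"
    if "x \<in> ?V" "l \<in> S" for x l using that by (simp_all add: arcs)
  have ab: "a l \<in> carrier L" "b l \<in> carrier L" if "l \<in> S" for l
    using that g by (auto simp: a_def b_def intro!: L.finsum_closed)
  have ba: "b l \<otimes>\<^bsub>L\<^esub> a m = (if l = m then \<one>\<^bsub>L\<^esub> else \<zero>\<^bsub>L\<^esub>)" if l: "l \<in> S" and m: "m \<in> S" for l m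
  proof -
    have "b l \<otimes>\<^bsub>L\<^esub> a m = (\<Oplus>\<^bsub>L\<^esub>x\<in>?V. gen (Ghost (x, l)) \<otimes>\<^bsub>L\<^esub> a m)"
      unfolding b_def using g l ab[OF m] by (intro L.finsum_ldistr) auto
    also have "\<dots> = (\<Oplus>\<^bsub>L\<^esub>x\<in>?V. if l = m then gen (Vertex (head E (x, l))) else \<zero>\<^bsub>L\<^esub>)"
    proof (rule L.finsum_cong')
      fix x assume x: "x \<in> ?V"
      have "gen (Ghost (x, l)) \<otimes>\<^bsub>L\<^esub> a m = (\<Oplus>\<^bsub>L\<^esub>y\<in>?V. gen (Ghost (x, l)) \<otimes>\<^bsub>L\<^esub> gen (Edge (y, m)))"
        unfolding a_def using g l m x by (intro L.finsum_rdistr) auto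
      also have "\<dots> = (\<Oplus>\<^bsub>L\<^esub>y\<in>?V. if y = x then (if l = m then gen (Vertex (head E (y, l))) else \<zero>\<^bsub>L\<^esub>) else \<zero>\<^bsub>L\<^esub>)"
        using g l m x by (intro L.finsum_cong') (auto simp: ghost_mult_edge_L arcs)
      also have "\<dots> = (if l = m then gen (Vertex (head E (x, l))) else \<zero>\<^bsub>L\<^esub>)"
        using g l m x by (intro L.finsum_delta) auto
      finally show "gen (Ghost (x, l)) \<otimes>\<^bsub>L\<^esub> a m = (if l = m then gen (Vertex (head E (x, l))) else \<zero>\<^bsub>L\<^esub>)" .
    qed (use g l in auto)
    also have "\<dots> = (if l = m then \<one>\<^bsub>L\<^esub> else \<zero>\<^bsub>L\<^esub>)"
    proof (cases "l = m")
      case True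
      have "(\<Oplus>\<^bsub>L\<^esub>v\<in>?V. gen (Vertex v)) = (\<Oplus>\<^bsub>L\<^esub>v\<in>(\<lambda>x. head E (x, l)) ` ?V. gen (Vertex v))"
        using perm[OF l] by (simp add: bij_betw_def)
      also have "\<dots> = (\<Oplus>\<^bsub>L\<^esub>x\<in>?V. gen (Vertex (head E (x, l))))"
        using perm[OF l] g l by (intro L.finsum_reindex) (auto simp: bij_betw_def)
      finally show ?thesis using True by (simp add: vertices_sum_one)
    qed simp
    finally show ?thesis .
  qed
  have diag: "a l \<otimes>\<^bsub>L\<^esub> b l = (\<Oplus>\<^bsub>L\<^esub>x\<in>?V. gen (Edge (x, l)) \<otimes>\<^bsub>L\<^esub> gen (Ghost (x, l)))" if l: "l \<in> S" for l
  proof -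
    have "a l \<otimes>\<^bsub>L\<^esub> b l = (\<Oplus>\<^bsub>L\<^esub>x\<in>?V. gen (Edge (x, l)) \<otimes>\<^bsub>L\<^esub> b l)"
      unfolding a_def using g l ab[OF l] by (intro L.finsum_ldistr) auto
    also have "\<dots> = (\<Oplus>\<^bsub>L\<^esub>x\<in>?V. gen (Edge (x, l)) \<otimes>\<^bsub>L\<^esub> gen (Ghost (x, l)))"
    proof (rule L.finsum_cong')
      fix x assume x: "x \<in> ?V"
      have "gen (Edge (x, l)) \<otimes>\<^bsub>L\<^esub> b l = (\<Oplus>\<^bsub>L\<^esub>y\<in>?V. gen (Edge (x, l)) \<otimes>\<^bsub>L\<^esub> gen (Ghost (y, l)))"
        unfolding b_def using g l x by (intro L.finsum_rdistr) auto
      also have "\<dots> = (\<Oplus>\<^bsub>L\<^esub>y\<in>?V. if y = x then gen (Edge (x, l)) \<otimes>\<^bsub>L\<^esub> gen (Ghost (y, l)) else \<zero>\<^bsub>L\<^esub>)"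
      proof (rule L.finsum_cong')
        fix y assume y: "y \<in> ?V"
        have "head E (x, l) \<noteq> head E (y, l)" if "y \<noteq> x"
          using perm[OF l] x y that by (auto simp: bij_betw_def inj_on_def)
        then show "gen (Edge (x, l)) \<otimes>\<^bsub>L\<^esub> gen (Ghost (y, l)) =
            (if y = x then gen (Edge (x, l)) \<otimes>\<^bsub>L\<^esub> gen (Ghost (y, l)) else \<zero>\<^bsub>L\<^esub>)"
          using x y l by (simp add: edge_mult_ghost_zero arcs)
      qed (use g l x in auto)
      also have "\<dots> = gen (Edge (x, l)) \<otimes>\<^bsub>L\<^esub> gen (Ghost (x, l))"
        using g l x by (intro L.finsum_delta) auto
      finally show "gen (Edge (x, l)) \<otimes>\<^bsub>L\<^esub> b l = gen (Edge (x, l)) \<otimes>\<^bsub>L\<^esub> gen (Ghost (x, l))" .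
    qed (use g l in auto)
    finally show ?thesis .
  qed
  have sum_ab: "(\<Oplus>\<^bsub>L\<^esub>l\<in>S. a l \<otimes>\<^bsub>L\<^esub> b l) = \<one>\<^bsub>L\<^esub>"
  proof -
    have "(\<Oplus>\<^bsub>L\<^esub>l\<in>S. a l \<otimes>\<^bsub>L\<^esub> b l) = (\<Oplus>\<^bsub>L\<^esub>l\<in>S. \<Oplus>\<^bsub>L\<^esub>x\<in>?V. gen (Edge (x, l)) \<otimes>\<^bsub>L\<^esub> gen (Ghost (x, l)))"
      using diag g by (intro L.finsum_cong') (auto intro!: L.finsum_closed)
    also have "\<dots> = (\<Oplus>\<^bsub>L\<^esub>x\<in>?V. \<Oplus>\<^bsub>L\<^esub>l\<in>S. gen (Edge (x, l)) \<otimes>\<^bsub>L\<^esub> gen (Ghost (x, l)))"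
      using g S by (intro L.finsum_swap) auto
    also have "\<dots> = (\<Oplus>\<^bsub>L\<^esub>x\<in>?V. gen (Vertex x))"
    proof (rule L.finsum_cong')
      fix x assume x: "x \<in> ?V"
      have out: "out_arcs E x = Pair x ` S" using x by (auto simp: out_arcs_def arcs tail)
      have "gen (Vertex x) = (\<Oplus>\<^bsub>L\<^esub>e\<in>Pair x ` S. gen (Edge e) \<otimes>\<^bsub>L\<^esub> gen (Ghost e))"
        using regular_vertex_sum[OF x] S out by (metis card.empty image_is_empty not_numeral_le_zero)
      also have "\<dots> = (\<Oplus>\<^bsub>L\<^esub>l\<in>S. gen (Edge (x, l)) \<otimes>\<^bsub>L\<^esub> gen (Ghost (x, l)))"
        using g x by (intro L.finsum_reindex) (auto simp: inj_on_def)
      finally show "(\<Oplus>\<^bsub>L\<^esub>l\<in>S. gen (Edge (x, l)) \<otimes>\<^bsub>L\<^esub> gen (Ghost (x, l))) = gen (Vertex x)" by simp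
    qed auto
    finally show ?thesis by (simp add: vertices_sum_one)
  qed
  obtain t where t: "bij_betw t {..<card S} S"
    using ex_bij_betw_nat_finite[OF S(1)] by (auto simp: atLeast0LessThan)
  have tS: "t i \<in> S" if "i < card S" for i using t that by (auto simp: bij_betw_def)
  show ?thesis
  proof (rule L.Leavitt_relations_imp_not_gr_IBN[OF S(2), of "\<lambda>i. a (t i)" "\<lambda>i. b (t i)" _ "\<lambda>_. -1"])
    show "b (t i) \<otimes>\<^bsub>L\<^esub> a (t j) = (if i = j then \<one>\<^bsub>L\<^esub> else \<zero>\<^bsub>L\<^esub>)" if "i < card S" "j < card S" for i j
      using ba[OF tS tS, OF that] t that by (auto simp: bij_betw_def inj_on_def)
    have "(\<Oplus>\<^bsub>L\<^esub>l\<in>t ` {..<card S}. a l \<otimes>\<^bsub>L\<^esub> b l) = (\<Oplus>\<^bsub>L\<^esub>i\<in>{..<card S}. a (t i) \<otimes>\<^bsub>L\<^esub> b (t i))"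
      using t ab tS by (intro L.finsum_reindex) (auto simp: bij_betw_def)
    then show "(\<Oplus>\<^bsub>L\<^esub>i\<in>{..<card S}. a (t i) \<otimes>\<^bsub>L\<^esub> b (t i)) = \<one>\<^bsub>L\<^esub>"
      using t sum_ab by (simp add: bij_betw_def)
    fix i \<gamma> X assume i: "i < card S" and X: "X \<in> lpa_grading K E \<gamma>"
    have "b (t i) \<in> lpa_grading K E (- 1)"
      unfolding b_def
    proof (rule lpa_grading_finsum)
      show "gen (Ghost (x, t i)) \<in> lpa_grading K E (- 1)" if "x \<in> ?V" for x
        using gen_in_lpa_grading[of "Ghost (x, t i)"] that tS[OF i] by (simp add: arcs)
    qed simp
    then show "b (t i) \<otimes>\<^bsub>L\<^esub> X \<in> lpa_grading K E (- 1 + \<gamma>)" using X by (rule lpa_grading_mult)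
  qed (use ab tS in auto)
qed

section \<open>Hopf graphs\<close>

text \<open>The part \<open>(C, c, i)\<close> of an edge that remains when its source is dropped. Edges with a given label
  \<open>(C, c, i)\<close> realise right multiplication by \<open>c\<close>, a permutation of the group.\<close>

definition hopf_labels :: "('g, 'n) monoid_scheme \<Rightarrow> ('g set \<Rightarrow> nat) \<Rightarrow> ('g set \<times> 'g \<times> nat) set" where
  "hopf_labels G r = (SIGMA C:conjugacy_classes G. C \<times> {..<r C})"

lemma arcs_hopf_graph: "arcs (hopf_graph G r) = carrier G \<times> hopf_labels G r"
  by (auto simp: hopf_graph_def hopf_labels_def)

lemma (in group) conjugacy_classes_finite:
  assumes "finite (carrier G)"
  shows "finite (conjugacy_classes G)" and "C \<in> conjugacy_classes G \<Longrightarrow> C \<subseteq> carrier G"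
    and "C \<in> conjugacy_classes G \<Longrightarrow> finite C"
proof -
  show sub: "C \<subseteq> carrier G" if "C \<in> conjugacy_classes G" for C
    using that by (auto simp: conjugacy_classes_def orbits_def orbit_def)
  show "C \<in> conjugacy_classes G \<Longrightarrow> finite C" using sub assms finite_subset by blast
  have "conjugacy_classes G \<subseteq> Pow (carrier G)" using sub by blast
  then show "finite (conjugacy_classes G)" by (rule finite_subset) (use assms in simp)
qed

text \<open>The number in the third statement is the number of labels, which is the out-degree of every vertex.\<close>

theorem proposition4p5:
  fixes K :: "('k, 'm) ring_scheme"
    and G :: "('g, 'n) monoid_scheme"
    and r :: "'g set \<Rightarrow> nat"
  assumes "field K" and "group G" and "finite (carrier G)"
  shows "(IBN (leavitt_path_algebra K (hopf_graph G r)) \<longleftrightarrow>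
            gr_IBN (leavitt_path_algebra K (hopf_graph G r)) (lpa_grading K (hopf_graph G r))) \<and>
         (gr_IBN (leavitt_path_algebra K (hopf_graph G r)) (lpa_grading K (hopf_graph G r)) \<longleftrightarrow>
            (\<Sum>C\<in>conjugacy_classes G. r C * card C) \<le> 1)"
proof -
  interpret G: group G by fact
  note cc = G.conjugacy_classes_finite[OF assms(3)]
  let ?E = "hopf_graph G r" and ?S = "hopf_labels G r"
  let ?L = "leavitt_path_algebra K ?E"
  have S: "finite ?S" using cc unfolding hopf_labels_def by (intro finite_SigmaI) auto
  have card_S: "card ?S = (\<Sum>C\<in>conjugacy_classes G. r C * card C)"
    unfolding hopf_labels_def using cc
    by (subst card_SigmaI) (auto simp: card_cartesian_product mult.commute)
  have verts: "verts ?E = carrier G" by (simp add: hopf_graph_def)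
  have tail: "tail ?E = fst" by (auto simp: hopf_graph_def fun_eq_iff)
  have head: "head ?E (x, l) = x \<otimes>\<^bsub>G\<^esub> fst (snd l)" for x l
    by (simp add: hopf_graph_def split_beta)
  have label: "fst (snd l) \<in> carrier G" if "l \<in> ?S" for l
    using that cc(2)[of "fst l"] by (auto simp: hopf_labels_def)
  have fin: "fin_digraph ?E"
    by unfold_locales (use S assms(3) label in \<open>auto simp: verts arcs_hopf_graph tail head\<close>)
  have IBN: "IBN ?L" if "(\<Sum>C\<in>conjugacy_classes G. r C * card C) \<le> 1"
  proof -
    interpret finite_lpa K ?E using assms(1) fin by (rule finite_lpa.intro)
    \<comment> \<open>with at most one label, an edge is determined by its source\<close>
    have "inj_on (tail ?E) (arcs ?E)"
      using that S unfolding card_S[symmetric] One_nat_def card_le_Suc0_iff_eq[OF S]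
      by (auto simp: inj_on_def arcs_hopf_graph tail)
    then show ?thesis
      by (rule IBN_if_out_degree_le_1) (use verts G.one_closed in auto)
  qed
  have not_gr_IBN: "\<not> gr_IBN ?L (lpa_grading K ?E)" if "\<not> (\<Sum>C\<in>conjugacy_classes G. r C * card C) \<le> 1"
  proof (rule not_gr_IBN_if_permutation_labelled[OF assms(1) fin _ tail S])
    show "arcs ?E = verts ?E \<times> ?S" by (simp add: arcs_hopf_graph verts)
    show "2 \<le> card ?S" using that card_S by simp
    show "bij_betw (\<lambda>x. head ?E (x, l)) (verts ?E) (verts ?E)" if "l \<in> ?S" for l
      unfolding verts head
      by (rule bij_betw_byWitness[of _ "\<lambda>x. x \<otimes>\<^bsub>G\<^esub> inv\<^bsub>G\<^esub> fst (snd l)"])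
         (use label[OF that] in \<open>auto simp: G.m_assoc\<close>)
  qed
  show ?thesis using IBN not_gr_IBN IBN_imp_gr_IBN by blast
qed

end
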